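(* Let $x^1,\dots,x^4$ be local coordinates on a coordinate domain $U$ in a four-manifold, let $\alpha,\gamma:U\to(-\pi/2,\pi/2)$ and $\beta,\delta:U\to\mathbb{R}$ be any smooth functions, and let $g$ and $J$ be defined from them by formulas (M) and (J) of the context. Let $\mathcal{H}$ and $\mathcal{V}$ be the distributions on $U$ spanned by the coordinate vector fields $\partial_1,\partial_2$ and, respectively, $\partial_3,\partial_4$. Then $g$ and $J$ always define an almost-Kähler metric, in the sense that $\omega=g(J\cdot,\cdot)$ is skew-symmetric and closed. The following five conditions are mutually equivalent. (i) The equations (a) $(-1)^p\beta_p=\alpha_q\,e^{(-1)^p\delta}\sec\gamma-\alpha_p\tan\gamma$ whenever $\{p,q\}=\{3,4\}$, (b) $(-1)^\lambda\delta_\lambda=\gamma_\mu\,e^{(-1)^\lambda\beta}\sec\alpha-\gamma_\lambda\tan\alpha$ whenever $\{\lambda,\mu\}=\{1,2\}$, hold on $U$, where the subscripts denote partial derivatives (no summation). (ii) $\nabla\omega=0$ for $\omega=g(J\cdot,\cdot)$ and the Levi-Civita connection $\nabla$ of $g$. (iii) $\nabla J=0$, that is, $g$ is a Kähler metric (with complex structure $J$). (iv) The almost-complex structure $J$ is integrable. (v) $\alpha+i\beta$ is $\mathcal{V}$-holomorphic and $\gamma+i\delta$ is $\mathcal{H}$-holomorphic. Furthermore: (vi) the first part of (v) ($\mathcal{V}$-holomorphicity of $\alpha+i\beta$) is equivalent to (a) in (i), and the second part of (v) ($\mathcal{H}$-holomorphicity of $\gamma+i\delta$) is equivalent to (b)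 in (i).
   Context: All manifolds, mappings and tensor fields are smooth. Convention: $J\partial_j=\sum_k J^k_j\,\partial_k$. (M) The metric $g$ is given by $(g_{11},g_{12},g_{22})=(e^{-\beta}\sec\alpha,\ \tan\alpha,\ e^{\beta}\sec\alpha)$, $(g_{33},g_{34},g_{44})=(e^{-\delta}\sec\gamma,\ \tan\gamma,\ e^{\delta}\sec\gamma)$, $g_{13}=g_{14}=g_{23}=g_{24}=0$. (J) The tensor $J$ is given by $J^1_1=-g_{12},\ J^1_2=-g_{22},\ J^2_1=g_{11},\ J^2_2=g_{12}$, $J^3_3=-g_{34},\ J^3_4=-g_{44},\ J^4_3=g_{33},\ J^4_4=g_{34}$, $J^p_\lambda=J^\lambda_p=0$ for $\lambda\in\{1,2\}$, $p\in\{3,4\}$. (It is an almost-complex structure, since $g_{11}g_{22}-g_{12}^2=g_{33}g_{44}-g_{34}^2=1$.) For an integrable complex-line subbundle $\mathcal{V}$ of the tangent bundle $TM$ of an almost-complex manifold $M$ (that is, an integrable $J$-invariant subbundle of real rank two), a function $\phi:M\to\mathbb{C}$ is called $\mathcal{V}$-holomorphic if the restriction of $\phi$ to every leaf of $\mathcal{V}$ is a holomorphic function on the leaf, where each leaf carries the complex-manifold structure (of complex dimension one) determined by the restriction of $J$. Here a function $\phi$ on a leaf is holomorphic when $(d\phi)J=i\,d\phi$ on the leaf. The same definition is used with $\mathcal{H}$ in place of $\mathcal{V}$. *)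

theory Defs
  imports "HOL-Analysis.Analysis"
begin

text \<open>
  The coordinate domain is identified, through the coordinates, with an open set
  \<open>U\<close> of \<open>real ^ 4\<close>. Indices have type \<open>4\<close>, whose elements are \<open>1\<close>, \<open>2\<close>, \<open>3\<close>, \<open>4\<close>
  (with \<open>4 = 0\<close> in this type).
\<close>

abbreviation coord_field :: "'n \<Rightarrow> real ^ 'n::finite" where
  "coord_field i \<equiv> axis i 1"

definition partial_deriv ::
  "'n \<Rightarrow> (real ^ 'n::finite \<Rightarrow> 'b::real_normed_vector) \<Rightarrow> real ^ 'n \<Rightarrow> 'b" where
  "partial_deriv i f x = frechet_derivative f (at x) (coord_field i)"

text \<open>\<open>Ck_on k S f\<close> and \<open>smooth_on S f\<close> are meant for open \<open>S\<close>.\<close>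

primrec Ck_on ::
  "nat \<Rightarrow> (real ^ 'n::finite) set \<Rightarrow> (real ^ 'n \<Rightarrow> 'b::real_normed_vector) \<Rightarrow> bool" where
  "Ck_on 0 S f \<longleftrightarrow> continuous_on S f"
| "Ck_on (Suc k) S f \<longleftrightarrow> f differentiable_on S \<and> (\<forall>i. Ck_on k S (partial_deriv i f))"

definition smooth_on ::
  "(real ^ 'n::finite) set \<Rightarrow> (real ^ 'n \<Rightarrow> 'b::real_normed_vector) \<Rightarrow> bool" where
  "smooth_on S f \<longleftrightarrow> (\<forall>k. Ck_on k S f)"

abbreviation sec :: "real \<Rightarrow> real" where
  "sec t \<equiv> 1 / cos t"


section \<open>Tensor fields on the coordinate domain\<close>

text \<open>
  A two-times covariant tensor field \<open>g\<close> has the components \<open>g x $ i $ j\<close>. A \<open>(1,1)\<close> tensor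
  field \<open>J\<close> has the components \<open>J x $ k $ j\<close>, standing for \<open>J\<^sup>k\<^sub>j\<close>: the convention
  \<open>J \<partial>\<^sub>j = (\<Sum>k. J\<^sup>k\<^sub>j \<partial>\<^sub>k)\<close> says that \<open>J\<close> acts on tangent vectors as \<open>J x *v v\<close>.
\<close>

type_synonym tensor_field = "real ^ 4 \<Rightarrow> real ^ 4 ^ 4"

definition smooth_tensor :: "(real ^ 4) set \<Rightarrow> tensor_field \<Rightarrow> bool" where
  "smooth_tensor U T \<longleftrightarrow> (\<forall>i j. smooth_on U (\<lambda>x. T x $ i $ j))"

definition riemannian_metric :: "(real ^ 4) set \<Rightarrow> tensor_field \<Rightarrow> bool" where
  "riemannian_metric U g \<longleftrightarrow> smooth_tensor U g \<and>
     (\<forall>x\<in>U. (\<forall>i j. g x $ i $ j = g x $ j $ i) \<and> (\<forall>v. v \<noteq> 0 \<longrightarrow> v \<bullet> (g x *v v) > 0))"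

definition almost_complex :: "(real ^ 4) set \<Rightarrow> tensor_field \<Rightarrow> bool" where
  "almost_complex U J \<longleftrightarrow> smooth_tensor U J \<and> (\<forall>x\<in>U. \<forall>v. J x *v (J x *v v) = - v)"

text \<open>\<open>\<omega> = g(J\<cdot>,\<cdot>)\<close>, so that \<open>\<omega>\<^sub>i\<^sub>j = g(J \<partial>\<^sub>i, \<partial>\<^sub>j)\<close>.\<close>

definition fundamental_form :: "tensor_field \<Rightarrow> tensor_field \<Rightarrow> tensor_field" where
  "fundamental_form g J x = (\<chi> i j. \<Sum>l\<in>UNIV. J x $ l $ i * g x $ l $ j)"

definition skew_symmetric :: "(real ^ 4) set \<Rightarrow> tensor_field \<Rightarrow> bool" where
  "skew_symmetric U w \<longleftrightarrow> (\<forall>x\<in>U. \<forall>i j. w x $ i $ j = - (w x $ j $ i))"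

text \<open>
  The components of the exterior derivative of a skew-symmetric \<open>w\<close> (up to a constant factor
  depending on conventions).
\<close>

definition closed_form :: "(real ^ 4) set \<Rightarrow> tensor_field \<Rightarrow> bool" where
  "closed_form U w \<longleftrightarrow> (\<forall>x\<in>U. \<forall>i j k.
     partial_deriv i (\<lambda>y. w y $ j $ k) x + partial_deriv j (\<lambda>y. w y $ k $ i) x
       + partial_deriv k (\<lambda>y. w y $ i $ j) x = 0)"

definition almost_kaehler :: "(real ^ 4) set \<Rightarrow> tensor_field \<Rightarrow> tensor_field \<Rightarrow> bool" where
  "almost_kaehler U g J \<longleftrightarrow> riemannian_metric U g \<and> almost_complex U J \<and>
     skew_symmetric U (fundamental_form g J) \<and> closed_form U (fundamental_form g J)"


section \<open>The Levi-Civita connection\<close>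

text \<open>\<open>christoffel g x k i j\<close> is \<open>\<Gamma>\<^sup>k\<^sub>i\<^sub>j\<close>, with \<open>\<nabla>\<close> of \<open>\<partial>\<^sub>j\<close> along \<open>\<partial>\<^sub>i\<close> equal to \<open>\<Sum>k. \<Gamma>\<^sup>k\<^sub>i\<^sub>j \<partial>\<^sub>k\<close>.\<close>

definition christoffel :: "tensor_field \<Rightarrow> real ^ 4 \<Rightarrow> 4 \<Rightarrow> 4 \<Rightarrow> 4 \<Rightarrow> real" where
  "christoffel g x k i j = (\<Sum>l\<in>UNIV. matrix_inv (g x) $ k $ l *
     (partial_deriv i (\<lambda>y. g y $ j $ l) x + partial_deriv j (\<lambda>y. g y $ i $ l) x
       - partial_deriv l (\<lambda>y. g y $ i $ j) x)) / 2"

definition nabla_covariant ::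
  "tensor_field \<Rightarrow> tensor_field \<Rightarrow> real ^ 4 \<Rightarrow> 4 \<Rightarrow> 4 \<Rightarrow> 4 \<Rightarrow> real" where
  "nabla_covariant g w x i j k = partial_deriv i (\<lambda>y. w y $ j $ k) x
     - (\<Sum>l\<in>UNIV. christoffel g x l i j * w x $ l $ k)
     - (\<Sum>l\<in>UNIV. christoffel g x l i k * w x $ j $ l)"

definition nabla_endomorphism ::
  "tensor_field \<Rightarrow> tensor_field \<Rightarrow> real ^ 4 \<Rightarrow> 4 \<Rightarrow> 4 \<Rightarrow> 4 \<Rightarrow> real" where
  "nabla_endomorphism g J x i k j = partial_deriv i (\<lambda>y. J y $ k $ j) x
     + (\<Sum>l\<in>UNIV. christoffel g x k i l * J x $ l $ j)
     - (\<Sum>l\<in>UNIV. christoffel g x l i j * J x $ k $ l)"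

definition parallel_form :: "(real ^ 4) set \<Rightarrow> tensor_field \<Rightarrow> tensor_field \<Rightarrow> bool" where
  "parallel_form U g w \<longleftrightarrow> (\<forall>x\<in>U. \<forall>i j k. nabla_covariant g w x i j k = 0)"

definition parallel_endomorphism :: "(real ^ 4) set \<Rightarrow> tensor_field \<Rightarrow> tensor_field \<Rightarrow> bool" where
  "parallel_endomorphism U g J \<longleftrightarrow> (\<forall>x\<in>U. \<forall>i k j. nabla_endomorphism g J x i k j = 0)"


section \<open>Integrability of an almost-complex structure\<close>

definition lie_bracket ::
  "(real ^ 4 \<Rightarrow> real ^ 4) \<Rightarrow> (real ^ 4 \<Rightarrow> real ^ 4) \<Rightarrow> real ^ 4 \<Rightarrow> real ^ 4" where
  "lie_bracket X Y x = frechet_derivative Y (at x) (X x) - frechet_derivative X (at x) (Y x)"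

definition nijenhuis ::
  "tensor_field \<Rightarrow> (real ^ 4 \<Rightarrow> real ^ 4) \<Rightarrow> (real ^ 4 \<Rightarrow> real ^ 4) \<Rightarrow> real ^ 4 \<Rightarrow> real ^ 4" where
  "nijenhuis J X Y x =
     (let JX = (\<lambda>y. J y *v X y); JY = (\<lambda>y. J y *v Y y) in
      lie_bracket JX JY x - J x *v lie_bracket JX Y x - J x *v lie_bracket X JY x
        - lie_bracket X Y x)"

text \<open>Integrability of \<open>J\<close> is understood as the absence of torsion, as in Kobayashi and Nomizu.\<close>

definition integrable_J :: "(real ^ 4) set \<Rightarrow> tensor_field \<Rightarrow> bool" where
  "integrable_J U J \<longleftrightarrow> (\<forall>X Y. smooth_on U X \<longrightarrow> smooth_on U Y \<longrightarrow>
     (\<forall>x\<in>U. nijenhuis J X Y x = 0))"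


section \<open>Leaves and leafwise holomorphic functions\<close>

text \<open>
  A distribution assigns to a point a subspace of the tangent space. A \<open>leaf_chart\<close> is a
  parametrization of a (possibly small) integral surface of the distribution \<open>D\<close>. For an
  integrable \<open>D\<close> of rank two the integral surfaces form a basis of the leaf topology, and the
  leaves (maximal connected integral surfaces) are the connected components of that topology.
\<close>

type_synonym distribution = "real ^ 4 \<Rightarrow> (real ^ 4) set"

definition leaf_chart ::
  "(real ^ 4) set \<Rightarrow> distribution \<Rightarrow> (real ^ 2) set \<Rightarrow> (real ^ 2 \<Rightarrow> real ^ 4) \<Rightarrow> bool" where
  "leaf_chart U D W s \<longleftrightarrow> open W \<and> smooth_on W s \<and> inj_on s W \<and> s ` W \<subseteq> U \<and>
     (\<forall>w\<in>W. inj (frechet_derivative s (at w)) \<and> range (frechet_derivative s (at w)) = D (s w))"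

definition leaf_topology :: "(real ^ 4) set \<Rightarrow> distribution \<Rightarrow> (real ^ 4) topology" where
  "leaf_topology U D = topology_generated_by {s ` W | W s. leaf_chart U D W s}"

definition leaves :: "(real ^ 4) set \<Rightarrow> distribution \<Rightarrow> (real ^ 4) set set" where
  "leaves U D = connected_components_of (leaf_topology U D)"

text \<open>
  The condition \<open>(d\<phi>) J = \<i> d\<phi>\<close> on each leaf, written in the charts \<open>s\<close> of the leaf: the
  complex structure of the leaf takes the vector \<open>u\<close> at \<open>w\<close> to the vector \<open>u'\<close> for which
  \<open>ds u' = J (ds u)\<close>. Meant for \<open>J\<close>-invariant integrable \<open>D\<close> of rank two.
\<close>

definition leafwise_holomorphic ::
  "(real ^ 4) set \<Rightarrow> tensor_field \<Rightarrow> distribution \<Rightarrow> (real ^ 4 \<Rightarrow> complex) \<Rightarrow> bool" where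
  "leafwise_holomorphic U J D \<phi> \<longleftrightarrow>
     (\<forall>L\<in>leaves U D. \<forall>W s. leaf_chart U D W s \<and> s ` W \<subseteq> L \<longrightarrow>
       (\<forall>w\<in>W. (\<phi> \<circ> s) differentiable (at w) \<and>
         (\<forall>u u'. frechet_derivative s (at w) u' = J (s w) *v frechet_derivative s (at w) u \<longrightarrow>
            frechet_derivative (\<phi> \<circ> s) (at w) u'
              = \<i> * frechet_derivative (\<phi> \<circ> s) (at w) u)))"

definition dist_H :: distribution where
  "dist_H x = span {coord_field 1, coord_field 2}"

definition dist_V :: distribution where
  "dist_V x = span {coord_field 3, coord_field 4}"


section \<open>The metric and the almost-complex structure\<close>

definition metric_M ::
  "(real ^ 4 \<Rightarrow> real) \<Rightarrow> (real ^ 4 \<Rightarrow> real) \<Rightarrow> (real ^ 4 \<Rightarrow> real) \<Rightarrow> (real ^ 4 \<Rightarrow> real) \<Rightarrow> tensor_field"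
  where
  "metric_M \<alpha> \<beta> \<gamma> \<delta> x = vector
     [vector [exp (- \<beta> x) * sec (\<alpha> x), tan (\<alpha> x), 0, 0],
      vector [tan (\<alpha> x), exp (\<beta> x) * sec (\<alpha> x), 0, 0],
      vector [0, 0, exp (- \<delta> x) * sec (\<gamma> x), tan (\<gamma> x)],
      vector [0, 0, tan (\<gamma> x), exp (\<delta> x) * sec (\<gamma> x)]]"

definition acs_J :: "tensor_field \<Rightarrow> tensor_field" where
  "acs_J g x = vector
     [vector [- (g x $ 1 $ 2), - (g x $ 2 $ 2), 0, 0],
      vector [g x $ 1 $ 1, g x $ 1 $ 2, 0, 0],
      vector [0, 0, - (g x $ 3 $ 4), - (g x $ 4 $ 4)],
      vector [0, 0, g x $ 3 $ 3, g x $ 3 $ 4]]"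

definition condition_a ::
  "(real ^ 4) set \<Rightarrow> (real ^ 4 \<Rightarrow> real) \<Rightarrow> (real ^ 4 \<Rightarrow> real) \<Rightarrow> (real ^ 4 \<Rightarrow> real) \<Rightarrow>
     (real ^ 4 \<Rightarrow> real) \<Rightarrow> bool" where
  "condition_a U \<alpha> \<beta> \<gamma> \<delta> \<longleftrightarrow> (\<forall>x\<in>U. \<forall>p q::nat. {p, q} = {3, 4} \<longrightarrow>
     (-1) ^ p * partial_deriv (of_nat p) \<beta> x =
       partial_deriv (of_nat q) \<alpha> x * exp ((-1) ^ p * \<delta> x) * sec (\<gamma> x)
         - partial_deriv (of_nat p) \<alpha> x * tan (\<gamma> x))"

definition condition_b ::
  "(real ^ 4) set \<Rightarrow> (real ^ 4 \<Rightarrow> real) \<Rightarrow> (real ^ 4 \<Rightarrow> real) \<Rightarrow> (real ^ 4 \<Rightarrow> real) \<Rightarrow>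
     (real ^ 4 \<Rightarrow> real) \<Rightarrow> bool" where
  "condition_b U \<alpha> \<beta> \<gamma> \<delta> \<longleftrightarrow> (\<forall>x\<in>U. \<forall>l m::nat. {l, m} = {1, 2} \<longrightarrow>
     (-1) ^ l * partial_deriv (of_nat l) \<delta> x =
       partial_deriv (of_nat m) \<gamma> x * exp ((-1) ^ l * \<beta> x) * sec (\<alpha> x)
         - partial_deriv (of_nat l) \<gamma> x * tan (\<alpha> x))"

end

theory Submission
  imports Defs
begin

text \<open>
  In every almost-Kaehler manifold the metric is parallel, so \<open>\<nabla>\<omega>\<close> and \<open>\<nabla>J\<close> are the same
  tensor up to lowering an index, and closedness of \<open>\<omega>\<close> gives
  \<open>g(N(X,Y), Z) = - 2 g((\<nabla>\<^sub>Z J) J X, Y)\<close> for the Nijenhuis tensor \<open>N\<close>; hence (ii), (iii)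
  and (iv) are equivalent. In the case at hand \<open>\<omega>\<close> has constant components. Since
  \<open>N(J X, Y) = - J N(X, Y)\<close>, and since \<open>J\<close> preserves both planes, \<open>N\<close> vanishes once
  \<open>N(\<partial>\<^sub>1, \<partial>\<^sub>3) = 0\<close>; the first two components of that equation are (a), the last two are (b).
  Finally, small coordinate plaques are contained in leaves, so leafwise holomorphicity is the
  pointwise Cauchy-Riemann condition on the two coordinate fields, which is (a) or (b) verbatim.
\<close>

section \<open>Smooth functions\<close>

text \<open>Conditions (ii), (iii) and (iv) see only the values and first derivatives of
  \<open>g\<close> and \<open>J\<close> at a point. Their equivalence is therefore linear algebra of
  the one-jet \<open>(G, J, dG, dJ)\<close>, constrained by the identities that come from
  differentiating symmetry, \<open>J J = -1\<close> and skewness, and by closedness. Absence of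
  torsion lets covariant derivatives replace partial ones in \<open>N\<close>; closedness then
  reduces the four resulting terms to one. The equation
  \<open>N(\<partial>1, \<partial>3) = 0\<close> splits because every derivative of \<open>J\<close>
  still preserves both planes: its first two components contain only derivatives of
  \<open>\<alpha>\<close>, \<open>\<beta>\<close> along \<open>\<partial>3\<close>,
  \<open>\<partial>4\<close>, the last two only derivatives of \<open>\<gamma>\<close>,
  \<open>\<delta>\<close> along \<open>\<partial>1\<close>, \<open>\<partial>2\<close>. The obstacle
  in (v) is that a leaf is a component of a topology generated by the images of arbitrary leaf
  charts. A test of the condition at a given point needs a chart through it inside a single leaf, so
  a plaque must be shown connected in that topology; this requires every such image to meet the
  plaque in a relatively open set.\<close>

lemma partial_deriv_eq:
  assumes "(f has_derivative f') (at x)"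
  shows "partial_deriv i f x = f' (coord_field i)"
  using frechet_derivative_at[OF assms] by (simp add: partial_deriv_def)

lemma partial_deriv_cong:
  assumes "open S" "x \<in> S" "\<And>y. y \<in> S \<Longrightarrow> f y = g y"
  shows "partial_deriv i f x = partial_deriv i g x"
proof -
  have "(f has_derivative f') (at x) \<longleftrightarrow> (g has_derivative f') (at x)" for f'
    using has_derivative_transform_within_open[OF _ assms(1,2)] assms(3) by metis
  then show ?thesis by (simp add: partial_deriv_def frechet_derivative_def)
qed

text \<open>On an open set, derivatives see only nearby values, so \<open>partial_deriv\<close> may
  be exchanged for an explicit formula that is valid on \<open>S\<close> alone.\<close>

lemma Ck_on_cong:
  assumes "open S" "\<And>x. x \<in> S \<Longrightarrow> f x = g x"
  shows "Ck_on k S f \<longleftrightarrow> Ck_on k S g"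
  using assms(2)
proof (induction k arbitrary: f g)
  case 0
  then show ?case by (simp cong: continuous_on_cong)
next
  case (Suc k)
  have "f differentiable_on S \<longleftrightarrow> g differentiable_on S"
    using Suc.prems differentiable_transform_within[of _ _ S 1]
    unfolding differentiable_on_def by (metis zero_less_one)
  moreover have "Ck_on k S (partial_deriv i f) \<longleftrightarrow> Ck_on k S (partial_deriv i g)" for i
    by (rule Suc.IH) (rule partial_deriv_cong[OF assms(1) _ Suc.prems])
  ultimately show ?case by simp
qed

lemma Ck_on_SucD: "Ck_on (Suc k) S f \<Longrightarrow> Ck_on k S f"
  by (induction k arbitrary: f) (auto intro: differentiable_imp_continuous_on)

lemma smooth_on_has_derivative:
  assumes "smooth_on S f" "open S" "x \<in> S"
  shows "(f has_derivative frechet_derivative f (at x)) (at x)"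
proof -
  have "Ck_on 1 S f" using assms(1) by (simp add: smooth_on_def)
  then show ?thesis
    using assms(2,3) by (simp add: differentiable_on_eq_differentiable_at frechet_derivative_works)
qed

lemma Ck_on_const: "Ck_on k (S :: (real^'n::finite) set) (\<lambda>_. c)"
proof (induction k arbitrary: c)
  case (Suc k)
  have "partial_deriv i (\<lambda>_::real^'n. c) = (\<lambda>_. 0)" for i
    by (auto simp: partial_deriv_eq[OF has_derivative_const])
  then show ?case using Suc by simp
qed simp

lemma smooth_on_const: "smooth_on S (\<lambda>_. c)"
  by (simp add: smooth_on_def Ck_on_const)

text \<open>The engine of the closure lemmas below: a pointwise derivative formula whose
  coefficients are already of class \<open>k\<close> gives class \<open>Suc k\<close>.\<close>

lemma Ck_on_SucI:
  assumes "open S" "\<And>x. x \<in> S \<Longrightarrow> (f has_derivative f' x) (at x)"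
    and "\<And>i. Ck_on k S (\<lambda>x. f' x (coord_field i))"
  shows "Ck_on (Suc k) S f"
proof -
  have "Ck_on k S (partial_deriv i f)" for i
    using assms(3)[of i] partial_deriv_eq[OF assms(2)]
    by (subst Ck_on_cong[OF assms(1)]) auto
  moreover have "f differentiable_on S"
    using assms(1,2) by (auto simp: differentiable_on_eq_differentiable_at differentiable_def)
  ultimately show ?thesis by simp
qed

lemma Ck_on_SucE:
  assumes "Ck_on (Suc k) S f" "open S"
  shows "\<And>x. x \<in> S \<Longrightarrow> (f has_derivative frechet_derivative f (at x)) (at x)"
    and "Ck_on k S (\<lambda>x. frechet_derivative f (at x) (coord_field i))"
proof -
  show "(f has_derivative frechet_derivative f (at x)) (at x)" if "x \<in> S" for x
    using assms that by (simp add: differentiable_on_eq_differentiable_at frechet_derivative_works)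
  have "Ck_on k S (partial_deriv i f)" using assms(1) by simp
  then show "Ck_on k S (\<lambda>x. frechet_derivative f (at x) (coord_field i))"
    by (simp add: partial_deriv_def[abs_def])
qed

lemma Ck_on_add:
  assumes "open S" "Ck_on k S f" "Ck_on k S g"
  shows "Ck_on k S (\<lambda>x. f x + g x)"
  using assms(2,3)
proof (induction k arbitrary: f g)
  case 0
  then show ?case by (simp add: continuous_on_add)
next
  case (Suc k)
  note f = Ck_on_SucE[OF Suc.prems(1) assms(1)] and g = Ck_on_SucE[OF Suc.prems(2) assms(1)]
  show ?case
    by (rule Ck_on_SucI[OF assms(1) has_derivative_add[OF f(1) g(1)]])
      (auto intro: Suc.IH f(2) g(2))
qed

lemma Ck_on_mult:
  fixes f g :: "real ^ 'n::finite \<Rightarrow> real"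
  assumes "open S" "Ck_on k S f" "Ck_on k S g"
  shows "Ck_on k S (\<lambda>x. f x * g x)"
  using assms(2,3)
proof (induction k arbitrary: f g)
  case 0
  then show ?case by (simp add: continuous_on_mult)
next
  case (Suc k)
  note f = Ck_on_SucE[OF Suc.prems(1) assms(1)] and g = Ck_on_SucE[OF Suc.prems(2) assms(1)]
  show ?case
    by (rule Ck_on_SucI[OF assms(1) has_derivative_mult[OF f(1) g(1)]])
      (auto intro!: Ck_on_add[OF assms(1)] Suc.IH Suc.prems[THEN Ck_on_SucD] f(2) g(2))
qed

lemma Ck_on_uminus:
  fixes f :: "real ^ 'n::finite \<Rightarrow> real"
  assumes "open S" "Ck_on k S f"
  shows "Ck_on k S (\<lambda>x. - f x)"
  using Ck_on_mult[OF assms(1) Ck_on_const assms(2), of "-1"] by simp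

lemma Ck_on_exp:
  fixes f :: "real ^ 'n::finite \<Rightarrow> real"
  assumes "open S" "Ck_on k S f"
  shows "Ck_on k S (\<lambda>x. exp (f x))"
  using assms(2)
proof (induction k arbitrary: f)
  case 0
  then show ?case by (auto intro: continuous_intros)
next
  case (Suc k)
  note f = Ck_on_SucE[OF Suc.prems assms(1)]
  show ?case
    by (rule Ck_on_SucI[OF assms(1) has_derivative_exp[OF f(1)]])
      (auto intro!: Ck_on_mult[OF assms(1)] Suc.IH Suc.prems[THEN Ck_on_SucD] f(2))
qed

text \<open>The derivative of each function contains the other, so the two statements go through one
  induction.\<close>

lemma Ck_on_sin_cos:
  fixes f :: "real ^ 'n::finite \<Rightarrow> real"
  assumes "open S" "Ck_on k S f"
  shows "Ck_on k S (\<lambda>x. sin (f x)) \<and> Ck_on k S (\<lambda>x. cos (f x))"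
  using assms(2)
proof (induction k arbitrary: f)
  case 0
  then show ?case by (auto intro: continuous_intros)
next
  case (Suc k)
  note f = Ck_on_SucE[OF Suc.prems assms(1)]
  note IH = Suc.IH[OF Suc.prems[THEN Ck_on_SucD]]
  have "Ck_on (Suc k) S (\<lambda>x. sin (f x))"
    by (rule Ck_on_SucI[OF assms(1) has_derivative_sin[OF f(1)]])
      (use IH in \<open>auto intro!: Ck_on_mult[OF assms(1)] f(2)\<close>)
  moreover have "Ck_on (Suc k) S (\<lambda>x. cos (f x))"
    by (rule Ck_on_SucI[OF assms(1) has_derivative_cos[OF f(1)]])
      (use IH in \<open>auto intro!: Ck_on_mult[OF assms(1)] Ck_on_uminus[OF assms(1)] f(2)\<close>)
  ultimately show ?case ..
qed

lemma Ck_on_inverse: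
  fixes f :: "real ^ 'n::finite \<Rightarrow> real"
  assumes "open S" "\<And>x. x \<in> S \<Longrightarrow> f x \<noteq> 0" "Ck_on k S f"
  shows "Ck_on k S (\<lambda>x. inverse (f x))"
  using assms(3)
proof (induction k)
  case 0
  then show ?case using assms(2) by (auto intro: continuous_intros)
next
  case (Suc k)
  note f = Ck_on_SucE[OF Suc.prems assms(1)]
  note IH = Suc.IH[OF Suc.prems[THEN Ck_on_SucD]]
  have d: "((\<lambda>x. inverse (f x)) has_derivative
      (\<lambda>h. - (inverse (f x) * frechet_derivative f (at x) h * inverse (f x)))) (at x)"
    if "x \<in> S" for x
    using Deriv.has_derivative_inverse[OF assms(2)[OF that] f(1)[OF that]] .
  show ?case
    by (rule Ck_on_SucI[OF assms(1) d])
      (auto intro!: Ck_on_uminus[OF assms(1)] Ck_on_mult[OF assms(1)] IH f(2))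
qed

lemma
  fixes f g :: "real ^ 'n::finite \<Rightarrow> real"
  assumes "open S" "smooth_on S f"
  shows smooth_on_uminus: "smooth_on S (\<lambda>x. - f x)"
    and smooth_on_exp: "smooth_on S (\<lambda>x. exp (f x))"
    and smooth_on_sin: "smooth_on S (\<lambda>x. sin (f x))"
    and smooth_on_cos: "smooth_on S (\<lambda>x. cos (f x))"
    and smooth_on_mult: "smooth_on S g \<Longrightarrow> smooth_on S (\<lambda>x. f x * g x)"
    and smooth_on_inverse: "(\<And>x. x \<in> S \<Longrightarrow> f x \<noteq> 0) \<Longrightarrow> smooth_on S (\<lambda>x. inverse (f x))"
  using assms by (auto simp: smooth_on_def Ck_on_uminus Ck_on_exp Ck_on_sin_cos Ck_on_mult
      Ck_on_inverse)

lemma smooth_on_affine: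
  assumes "bounded_linear l" "open S"
  shows "smooth_on S (\<lambda>w. x + l w)"
proof -
  have d: "((\<lambda>w. x + l w) has_derivative l) (at w)" for w
    by (auto intro!: derivative_eq_intros bounded_linear_imp_has_derivative[OF assms(1)])
  have "Ck_on k S (\<lambda>w. x + l w)" for k
  proof (cases k)
    case 0
    then show ?thesis
      using d by (auto intro: continuous_at_imp_continuous_on has_derivative_continuous)
  next
    case (Suc j)
    then show ?thesis using Ck_on_SucI[OF assms(2) d Ck_on_const] by blast
  qed
  then show ?thesis by (simp add: smooth_on_def)
qed

section \<open>Derivatives of tensor fields\<close>

lemma has_derivative_vec_lambda:
  fixes f :: "'i::finite \<Rightarrow> 'a::real_normed_vector \<Rightarrow> 'b::euclidean_space"
  assumes "\<And>i. (f i has_derivative f' i) F"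
  shows "((\<lambda>x. \<chi> i. f i x) has_derivative (\<lambda>h. \<chi> i. f' i h)) F"
proof -
  have eq: "(\<chi> i. v i) = (\<Sum>i\<in>UNIV. axis i (v i))" for v :: "'i \<Rightarrow> 'b"
    by (vector axis_def) (simp add: vec_eq_iff axis_def)
  have "bounded_linear (axis i :: 'b \<Rightarrow> 'b ^ 'i)" for i
    by (auto intro!: bounded_linearI' simp: axis_def vec_eq_iff)
  then show ?thesis
    unfolding eq by (auto intro!: has_derivative_sum bounded_linear.has_derivative[OF _ assms])
qed

lemma bounded_bilinear_matrix_vector:
  "bounded_bilinear (\<lambda>(A::real^'n^'m) v. A *v v)"
  by (auto simp: bilinear_conv_bounded_bilinear[symmetric] bilinear_def linear_iff
    matrix_vector_mult_add_rdistrib matrix_vector_right_distrib matrix_scaleR_vector_ac matrix_vector_mult_scaleR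
    scaleR_matrix_vector_assoc)

lemma axis_inner_matrix_axis: "axis j 1 \<bullet> ((M::real^'n^'m) *v axis l 1) = M $ j $ l"
  by (simp add: matrix_vector_mult_basis column_def inner_axis')

lemma matrix_vector_axis_nth: "((M::real^'n^'m) *v axis l 1) $ j = M $ j $ l"
  by (simp add: matrix_vector_mult_basis column_def)

lemma linear_axis_expansion:
  assumes "linear f"
  shows "f v = (\<Sum>l\<in>UNIV. (v $ l) *\<^sub>R f (axis l 1 :: real^'n))"
proof -
  have "f v = f (\<Sum>l\<in>UNIV. v $ l *\<^sub>R axis l 1)"
    using basis_expansion[of v] by (simp add: scalar_mult_eq_scaleR)
  also have "\<dots> = (\<Sum>l\<in>UNIV. (v $ l) *\<^sub>R f (axis l 1 :: real^'n))"
    using assms by (simp add: linear_sum linear_scale)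
  finally show ?thesis .
qed

lemma linear_eq_0_axis:
  assumes "linear f" "\<And>l. f (axis l 1 :: real^'n) = 0"
  shows "f v = 0"
  by (subst linear_axis_expansion[OF assms(1)]) (simp add: assms(2))

text \<open>Smoothness is given entry by entry; the product rule for \<open>*v\<close> needs one
  matrix-valued derivative.\<close>

lemma smooth_tensor_has_derivative:
  assumes "smooth_tensor U T" "open U" "x \<in> U"
  shows "(T has_derivative frechet_derivative T (at x)) (at x)"
proof -
  have "((\<lambda>y. T y $ i $ j) has_derivative frechet_derivative (\<lambda>y. T y $ i $ j) (at x)) (at x)"
    for i j
    using assms by (auto simp: smooth_tensor_def intro: smooth_on_has_derivative)
  then have "((\<lambda>y. \<chi> i j. T y $ i $ j) has_derivative
      (\<lambda>h. \<chi> i j. frechet_derivative (\<lambda>y. T y $ i $ j) (at x) h)) (at x)"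
    by (intro has_derivative_vec_lambda)
  then have "T differentiable (at x)"
    by (auto simp: differentiable_def)
  then show ?thesis
    by (simp add: frechet_derivative_works)
qed

lemma partial_deriv_tensor_component:
  fixes T :: tensor_field
  assumes "(T has_derivative T') (at x)"
  shows "partial_deriv i (\<lambda>y. T y $ j $ k) x = T' (coord_field i) $ j $ k"
  by (rule partial_deriv_eq)
    (intro bounded_linear.has_derivative[OF bounded_linear_vec_nth] assms)

lemma has_derivative_matrix_vector:
  assumes "(A has_derivative A') (at x)" "(v has_derivative v') (at x)"
  shows "((\<lambda>y. (A y :: real^'n^'m) *v v y) has_derivative (\<lambda>h. A x *v v' h + A' h *v v x)) (at x)"
  by (rule bounded_bilinear.FDERIV[OF bounded_bilinear_matrix_vector assms])

section \<open>The linear algebra of the first jet of an almost-Kaehler structure\<close>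

text \<open>The Nijenhuis tensor on fields with values \<open>u\<close>, \<open>v\<close> at the
  point: with \<open>J J = -1\<close> the derivatives of the fields cancel, and only
  \<open>J\<close> and its derivative \<open>dJ\<close> remain.\<close>

definition nijenhuis_jet ::
  "real^4^4 \<Rightarrow> (real^4 \<Rightarrow> real^4^4) \<Rightarrow> real^4 \<Rightarrow> real^4 \<Rightarrow> real^4" where
  "nijenhuis_jet J dJ u v =
     dJ (J *v u) *v v - dJ (J *v v) *v u + J *v (dJ v *v u) - J *v (dJ u *v v)"

lemma
  fixes J :: "real^4^4"
  assumes "linear dJ"
  shows linear_nijenhuis_jet_left: "linear (\<lambda>u. nijenhuis_jet J dJ u v)"
    and linear_nijenhuis_jet_right: "linear (\<lambda>v. nijenhuis_jet J dJ u v)"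
  using assms
  by (auto intro!: linearI simp: nijenhuis_jet_def linear_add linear_scale algebra_simps
      matrix_vector_right_distrib matrix_vector_mult_add_rdistrib matrix_vector_mult_scaleR
      simp flip: scaleR_matrix_vector_assoc)

lemma matrix_vector_mult_minus_right: "(A::real^'n^'m) *v (- x) = - (A *v x)"
  using matrix_vector_mult_scaleR[of A "-1" x] by simp

lemma nijenhuis_jet_antisym: "nijenhuis_jet J dJ v u = - nijenhuis_jet J dJ u v"
  by (simp add: nijenhuis_jet_def)

text \<open>Differentiating \<open>J J = -1\<close> shows that each \<open>dJ u\<close> anticommutes
  with \<open>J\<close>, which makes the tensor conjugate-linear.\<close>

lemma nijenhuis_jet_J:
  assumes "linear dJ" "\<And>v. J *v (J *v v) = - v"
    and "\<And>u v. dJ u *v (J *v v) + J *v (dJ u *v v) = 0"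
  shows "nijenhuis_jet J dJ (J *v u) v = - (J *v nijenhuis_jet J dJ u v)"
proof -
  have "dJ u *v (J *v v) = - (J *v (dJ u *v v))" for u v
    using assms(3) by (simp add: eq_neg_iff_add_eq_0)
  moreover have "dJ (- u) *v v = - (dJ u *v v)" for u v
    using matrix_vector_mult_add_rdistrib[of "dJ u" "dJ (-u)" v] linear_add[OF assms(1), of u "-u"]
    by (simp add: linear_0[OF assms(1)] eq_neg_iff_add_eq_0 add.commute)
  ultimately show ?thesis
    by (simp add: nijenhuis_jet_def assms(2) matrix_vector_right_distrib
      matrix_vector_mult_diff_distrib matrix_vector_mult_minus_right)
qed

text \<open>An almost-Kaehler structure seen at one point, with \<open>dG\<close> and
  \<open>dJ\<close> standing for the derivatives of the two fields. The three \<open>omega\<close>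
  assumptions are written out by the product rule for \<open>(J u) \<bullet> (G v)\<close>.\<close>

locale almost_kaehler_jet =
  fixes G J :: "real^4^4" and dG dJ :: "real^4 \<Rightarrow> real^4^4"
  assumes linear_dG: "linear dG" and linear_dJ: "linear dJ"
    and G_sym: "u \<bullet> (G *v v) = v \<bullet> (G *v u)"
    and dG_sym: "u \<bullet> (dG w *v v) = v \<bullet> (dG w *v u)"
    and G_pos: "v \<noteq> 0 \<Longrightarrow> v \<bullet> (G *v v) > 0"
    and J_J: "J *v (J *v v) = - v"
    and dJ_J: "dJ u *v (J *v v) + J *v (dJ u *v v) = 0"
    and omega_skew: "(J *v u) \<bullet> (G *v v) = - ((J *v v) \<bullet> (G *v u))"
    and domega_skew: "(dJ w *v u) \<bullet> (G *v v) + (J *v u) \<bullet> (dG w *v v) =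
      - ((dJ w *v v) \<bullet> (G *v u) + (J *v v) \<bullet> (dG w *v u))"
    and domega_closed: "(dJ u *v v) \<bullet> (G *v w) + (J *v v) \<bullet> (dG u *v w) +
      ((dJ v *v w) \<bullet> (G *v u) + (J *v w) \<bullet> (dG v *v u)) +
      ((dJ w *v u) \<bullet> (G *v v) + (J *v u) \<bullet> (dG w *v v)) = 0"
begin

lemma G_nondegenerate:
  assumes "\<And>w. v \<bullet> (G *v w) = 0"
  shows "v = 0"
  using G_pos[of v] assms[of v] by fastforce

text \<open>\<open>matrix_inv\<close> is a choice that is meaningful only for invertible matrices;
  positivity makes the kernel of \<open>G\<close> trivial.\<close>

lemma G_matrix_inv: "G *v (matrix_inv G *v v) = v"
proof -
  have "\<forall>x. G *v x = 0 \<longrightarrow> x = 0" using G_pos by fastforce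
  then have "invertible G"
    by (simp add: invertible_left_inverse matrix_left_invertible_ker)
  then have "G ** matrix_inv G = mat 1"
    using someI_ex[of "\<lambda>A'. G ** A' = mat 1 \<and> A' ** G = mat 1"]
    by (simp add: invertible_def matrix_inv_def)
  then show ?thesis by (simp add: matrix_vector_mul_assoc)
qed

text \<open>Christoffel symbols of the first kind, made bilinear in \<open>u\<close> and
  \<open>v\<close>: the Koszul formula for constant fields.\<close>

definition gamma_lower :: "real^4 \<Rightarrow> real^4 \<Rightarrow> real^4" where
  "gamma_lower u v = (\<chi> l. (v \<bullet> (dG u *v axis l 1) + u \<bullet> (dG v *v axis l 1)
     - u \<bullet> (dG (axis l 1) *v v)) / 2)"

definition gamma :: "real^4 \<Rightarrow> real^4 \<Rightarrow> real^4" where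
  "gamma u v = matrix_inv G *v gamma_lower u v"

definition nabla_J :: "real^4 \<Rightarrow> real^4 \<Rightarrow> real^4" where
  "nabla_J u v = dJ u *v v + gamma u (J *v v) - J *v gamma u v"

definition domega :: "real^4 \<Rightarrow> real^4 \<Rightarrow> real^4 \<Rightarrow> real" where
  "domega w u v = (dJ w *v u) \<bullet> (G *v v) + (J *v u) \<bullet> (dG w *v v)"

lemmas bilinear_simps = linear_add[OF linear_dG] linear_scale[OF linear_dG]
  linear_add[OF linear_dJ] linear_scale[OF linear_dJ] algebra_simps
  matrix_vector_right_distrib matrix_vector_mult_add_rdistrib matrix_vector_mult_scaleR
  scaleR_matrix_vector_assoc[symmetric] inner_add_left inner_add_right

lemma gamma_lower_inner:
  "gamma_lower u v \<bullet> w = (v \<bullet> (dG u *v w) + u \<bullet> (dG v *v w) - u \<bullet> (dG w *v v)) / 2"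
    (is "_ = ?f w")
proof -
  have "linear ?f"
    by (rule linearI) (simp_all add: bilinear_simps add_divide_distrib diff_divide_distrib)
  have "gamma_lower u v \<bullet> w = (\<Sum>l\<in>UNIV. w $ l *\<^sub>R ?f (axis l 1))"
    by (simp add: inner_vec_def[of _ w] mult.commute) (simp add: gamma_lower_def)
  also have "\<dots> = ?f w"
    using linear_axis_expansion[OF \<open>linear ?f\<close>, of w] by simp
  finally show ?thesis .
qed

lemma gamma_lower_sym: "gamma_lower u v = gamma_lower v u"
  by (simp add: gamma_lower_def dG_sym[of u _ v] add.commute)

lemma linear_gamma_lower: "linear (gamma_lower u)"
  by (rule linearI)
    (simp_all add: gamma_lower_def vec_eq_iff bilinear_simps add_divide_distrib diff_divide_distrib)

lemma linear_gamma: "linear (gamma u)"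
  by (rule linearI) (simp_all add: gamma_def linear_add[OF linear_gamma_lower]
      linear_scale[OF linear_gamma_lower] matrix_vector_right_distrib matrix_vector_mult_scaleR)

lemma gamma_sym: "gamma u v = gamma v u"
  by (simp add: gamma_def gamma_lower_sym[of u])

lemma G_gamma: "u \<bullet> (G *v gamma v w) = u \<bullet> gamma_lower v w"
  by (simp add: gamma_def G_matrix_inv)

lemma linear_nabla_J:
  shows "linear (nabla_J u)" and "linear (\<lambda>u. nabla_J u v)"
proof -
  show "linear (nabla_J u)"
    by (rule linearI) (simp_all add: nabla_J_def bilinear_simps linear_add[OF linear_gamma]
        linear_scale[OF linear_gamma])
  show "linear (\<lambda>u. nabla_J u v)"
    by (rule linearI) (simp_all add: nabla_J_def gamma_sym[of _ v] gamma_sym[of _ "J *v v"] 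
        bilinear_simps linear_add[OF linear_gamma] linear_scale[OF linear_gamma])
qed

lemma nabla_J_J: "nabla_J u (J *v v) = - (J *v nabla_J u v)"
proof -
  have "gamma u (- v) = - gamma u v" by (simp add: linear_neg[OF linear_gamma])
  moreover have "dJ u *v (J *v v) = - (J *v (dJ u *v v))"
    using dJ_J by (simp add: eq_neg_iff_add_eq_0)
  ultimately show ?thesis
    by (simp add: nabla_J_def J_J matrix_vector_right_distrib matrix_vector_mult_diff_distrib)
qed

text \<open>The metric is parallel, so \<open>\<nabla>\<omega>\<close> is obtained from \<open>\<nabla>J\<close> by lowering an index.\<close>

lemma nabla_omega:
  "domega w u v - (J *v gamma w u) \<bullet> (G *v v) - (J *v u) \<bullet> (G *v gamma w v)
    = nabla_J w u \<bullet> (G *v v)"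
proof -
  \<comment> \<open>Metric compatibility: in the sum of the two Koszul expressions all terms except
    the derivative along \<open>w\<close> cancel by symmetry of \<open>dG\<close>.\<close>
  have "(J *v u) \<bullet> (dG w *v v) = gamma w (J *v u) \<bullet> (G *v v) + (J *v u) \<bullet> (G *v gamma w v)"
    by (simp add: G_sym[of "gamma w (J *v u)"] G_gamma gamma_lower_inner
      inner_commute[of _ "gamma_lower _ _"])
      (simp add: dG_sym[of v w "J *v u"] dG_sym[of v "J *v u" w] dG_sym[of "J *v u" v w] field_simps)
  then show ?thesis
    by (simp add: domega_def nabla_J_def inner_add_left inner_diff_left)
qed

text \<open>This is the derivative of \<open>\<omega>\<close> along \<open>w\<close>, evaluated on
  \<open>u\<close>, \<open>v\<close>, by \<open>nabla_omega\<close>.\<close>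

abbreviation B :: "real^4 \<Rightarrow> real^4 \<Rightarrow> real^4 \<Rightarrow> real" where
  "B w u v \<equiv> nabla_J w u \<bullet> (G *v v)"

lemma J_adjoint: "(J *v u) \<bullet> (G *v v) = - (u \<bullet> (G *v (J *v v)))"
  by (metis omega_skew G_sym)

lemma B_skew: "B w u v = - B w v u"
  unfolding nabla_omega[symmetric] domega_def
  using domega_skew[of w u v] omega_skew[of "gamma w u" v] omega_skew[of u "gamma w v"] by simp

text \<open>The six connection terms of the cyclic sum cancel in pairs, since \<open>gamma\<close>
  is symmetric and \<open>\<omega>\<close> is skew; closedness disposes of the rest.\<close>

lemma B_cyclic: "B u v w + B v w u + B w u v = 0"
  unfolding nabla_omega[symmetric] domega_def
  using domega_closed[of u v w] omega_skew[of v "gamma u w"] omega_skew[of w "gamma v u"]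
    omega_skew[of u "gamma w v"] gamma_sym[of u v] gamma_sym[of v w] gamma_sym[of u w]
  by simp

text \<open>\<open>\<nabla>J\<close> anticommutes with \<open>J\<close>, and \<open>J\<close> is
  skew-adjoint for \<open>G\<close>; the two signs cancel.\<close>

lemma B_J: "B w (J *v u) v = B w u (J *v v)"
  by (simp add: nabla_J_J J_adjoint)

text \<open>All connection terms on the right cancel in pairs, by symmetry of \<open>gamma\<close>
  and \<open>J J = -1\<close>.\<close>

lemma nijenhuis_eq_nabla_J:
  "nijenhuis_jet J dJ u v =
     nabla_J (J *v u) v - nabla_J (J *v v) u + J *v nabla_J v u - J *v nabla_J u v"
  by (simp add: nijenhuis_jet_def nabla_J_def J_J matrix_vector_right_distrib
    matrix_vector_mult_diff_distrib gamma_sym[of v u] gamma_sym[of "J *v v" "J *v u"]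
    gamma_sym[of "J *v v" u] gamma_sym[of "J *v u" v])

lemma nijenhuis_inner: "nijenhuis_jet J dJ u v \<bullet> (G *v w) = - 2 * B w (J *v u) v"
proof -
  have "nijenhuis_jet J dJ u v \<bullet> (G *v w) =
      B (J *v u) v w - B (J *v v) u w - B v u (J *v w) + B u v (J *v w)"
    by (simp add: nijenhuis_eq_nabla_J inner_add_left inner_diff_left J_adjoint)
  \<comment> \<open>\<open>B_cyclic\<close> at \<open>(J u, v, w)\<close> and
    \<open>(J v, u, w)\<close>, with \<open>B_J\<close> moving \<open>J\<close> between slots,
    cancels the terms in \<open>J w\<close>. What is left,
    \<open>- B w (J u) v + B w (J v) u\<close>, consists of two equal summands.\<close>
  then show ?thesis
    using B_cyclic[of u v "J *v w"] B_cyclic[of "J *v u" v w] B_cyclic[of "J *v v" u w]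
      B_skew[of v w "J *v u"] B_skew[of u w "J *v v"] B_skew[of v u "J *v w"] B_skew[of u v "J *v w"]
      B_J[of v w u] B_J[of u w v] B_J[of v u w] B_J[of u v w] B_J[of w u v] B_J[of w v u]
      B_skew[of w "J *v u" v] B_skew[of w u "J *v v"] B_skew[of u "J *v w" v] B_skew[of v "J *v w" u]
    by linarith
qed

lemma nijenhuis_jet_eq_0_iff:
  "(\<forall>u v. nijenhuis_jet J dJ u v = 0) \<longleftrightarrow> (\<forall>u v. nabla_J u v = 0)"
proof
  assume N: "\<forall>u v. nijenhuis_jet J dJ u v = 0"
  have "nabla_J w (J *v u) = 0" for w u
    by (rule G_nondegenerate) (use nijenhuis_inner[of u _ w] N in simp)
  then have "nabla_J w (J *v (J *v u)) = 0" for w u by blast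
  then show "\<forall>u v. nabla_J u v = 0" by (simp add: J_J linear_neg[OF linear_nabla_J(1)])
qed (simp add: nijenhuis_eq_nabla_J)

end


section \<open>Almost-Kaehler structures on a coordinate domain\<close>

lemma has_derivative_eq_on_open:
  assumes "(f has_derivative f') (at x)" "(g has_derivative g') (at x)"
    and "open S" "x \<in> S" "\<And>y. y \<in> S \<Longrightarrow> f y = g y"
  shows "f' h = g' h"
  using has_derivative_unique[OF has_derivative_transform_within_open[OF assms(1,3-5)] assms(2)]
  by (simp add: fun_eq_iff)

lemma fundamental_form_inner:
  "fundamental_form g J y $ i $ j = (J y *v axis i 1) \<bullet> (g y *v axis j 1)"
  by (simp add: fundamental_form_def inner_vec_def matrix_vector_axis_nth)

lemma symmetric_matrix_inner:
  fixes A :: "real^'n^'n"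
  assumes "\<And>i j. A $ i $ j = A $ j $ i"
  shows "u \<bullet> (A *v v) = v \<bullet> (A *v u)"
proof -
  have "transpose A = A" using assms by (simp add: transpose_def vec_eq_iff)
  then show ?thesis using dot_lmul_matrix[of u A v] by (metis inner_commute transpose_matrix_vector)
qed

text \<open>Identities that hold throughout the open set can be differentiated at \<open>x\<close>.
  Skewness and closedness are given on coordinate fields only and are extended to all vectors one
  slot at a time.\<close>

lemma almost_kaehler_jet_at:
  assumes U: "open U" "x \<in> U" and ak: "almost_kaehler U g J"
  shows "almost_kaehler_jet (g x) (J x) (frechet_derivative g (at x)) (frechet_derivative J (at x))"
    (is "almost_kaehler_jet _ _ ?dG ?dJ")
proof -
  have dg: "(g has_derivative ?dG) (at x)" and dJ: "(J has_derivative ?dJ) (at x)"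
    using ak by (auto simp: almost_kaehler_def riemannian_metric_def almost_complex_def
        intro!: smooth_tensor_has_derivative[OF _ U])
  have lin: "linear ?dG" "linear ?dJ"
    using dg dJ has_derivative_linear by auto
  note bilinear_simps = linear_add[OF lin(1)] linear_scale[OF lin(1)] linear_add[OF lin(2)]
    linear_scale[OF lin(2)] algebra_simps
    matrix_vector_right_distrib matrix_vector_mult_add_rdistrib matrix_vector_mult_scaleR
    scaleR_matrix_vector_assoc[symmetric] inner_add_left inner_add_right
  have sym: "u \<bullet> (g y *v v) = v \<bullet> (g y *v u)" if "y \<in> U" for y u v
    by (rule symmetric_matrix_inner)
      (use ak that in \<open>auto simp: almost_kaehler_def riemannian_metric_def\<close>)
  have JJ: "J y *v (J y *v v) = - v" if "y \<in> U" for y v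
    using ak that by (simp add: almost_kaehler_def almost_complex_def)
  have skew: "(J y *v u) \<bullet> (g y *v v) = - ((J y *v v) \<bullet> (g y *v u))" if "y \<in> U" for y u v
  proof -
    let ?s = "\<lambda>u v. (J y *v u) \<bullet> (g y *v v) + (J y *v v) \<bullet> (g y *v u)"
    have axes: "?s (axis i 1) (axis j 1) = 0" for i j
    proof -
      have "fundamental_form g J y $ i $ j = - fundamental_form g J y $ j $ i"
        using ak that unfolding almost_kaehler_def skew_symmetric_def by blast
      then show ?thesis unfolding fundamental_form_inner by linarith
    qed
    have s1: "?s u (axis j 1) = 0" for j
      by (rule linear_eq_0_axis[of "\<lambda>u. ?s u (axis j 1)", OF _ axes])
        (rule linearI; simp add: bilinear_simps)
    have "?s u v = 0"
      by (rule linear_eq_0_axis[of "?s u", OF _ s1]) (rule linearI; simp add: bilinear_simps)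
    then show ?thesis by simp
  qed
  have d\<omega>: "((\<lambda>y. (J y *v u) \<bullet> (g y *v v)) has_derivative
      (\<lambda>h. (?dJ h *v u) \<bullet> (g x *v v) + (J x *v u) \<bullet> (?dG h *v v))) (at x)" for u v
    by (rule derivative_eq_intros has_derivative_matrix_vector dg dJ | simp add: add.commute)+
  show ?thesis
  proof (rule almost_kaehler_jet.intro)
    show "u \<bullet> (?dG w *v v) = v \<bullet> (?dG w *v u)" for u v w
    proof -
      have "((\<lambda>y. u \<bullet> (g y *v v)) has_derivative (\<lambda>h. u \<bullet> (?dG h *v v))) (at x)" for u v
        by (rule derivative_eq_intros has_derivative_matrix_vector dg | simp)+
      from has_derivative_eq_on_open[OF this this U sym] show ?thesis .
    qed
    show "?dJ u *v (J x *v v) + J x *v (?dJ u *v v) = 0" for u v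
    proof -
      have "((\<lambda>y. J y *v (J y *v v)) has_derivative
          (\<lambda>h. ?dJ h *v (J x *v v) + J x *v (?dJ h *v v))) (at x)"
        using has_derivative_matrix_vector[OF dJ has_derivative_matrix_vector[OF dJ
            has_derivative_const[of v]]] by (simp add: add.commute)
      from has_derivative_eq_on_open[OF this has_derivative_const U JJ] show ?thesis .
    qed
    show "(?dJ w *v u) \<bullet> (g x *v v) + (J x *v u) \<bullet> (?dG w *v v) =
        - ((?dJ w *v v) \<bullet> (g x *v u) + (J x *v v) \<bullet> (?dG w *v u))" for u v w
      by (rule has_derivative_eq_on_open[OF d\<omega> has_derivative_minus[OF d\<omega>] U skew])
    let ?d = "\<lambda>u v w. (?dJ u *v v) \<bullet> (g x *v w) + (J x *v v) \<bullet> (?dG u *v w)"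
    let ?c = "\<lambda>u v w. ?d u v w + ?d v w u + ?d w u v"
    have p: "partial_deriv i (\<lambda>y. fundamental_form g J y $ j $ k) x
        = ?d (axis i 1) (axis j 1) (axis k 1)" for i j k
      unfolding fundamental_form_inner by (rule partial_deriv_eq[OF d\<omega>])
    have axes: "?c (axis i 1) (axis j 1) (axis k 1) = 0" for i j k
    proof -
      have "partial_deriv i (\<lambda>y. fundamental_form g J y $ j $ k) x
          + partial_deriv j (\<lambda>y. fundamental_form g J y $ k $ i) x
          + partial_deriv k (\<lambda>y. fundamental_form g J y $ i $ j) x = 0"
        using ak U(2) unfolding almost_kaehler_def closed_form_def by blast
      then show ?thesis unfolding p .
    qed
    have c1: "?c u (axis j 1) (axis k 1) = 0" for u j k
      by (rule linear_eq_0_axis[of "\<lambda>u. ?c u (axis j 1) (axis k 1)", OF _ axes])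
        (rule linearI; simp add: bilinear_simps)
    have c2: "?c u v (axis k 1) = 0" for u v k
      by (rule linear_eq_0_axis[of "\<lambda>v. ?c u v (axis k 1)", OF _ c1])
        (rule linearI; simp add: bilinear_simps)
    show "?c u v w = 0" for u v w
      by (rule linear_eq_0_axis[of "?c u v", OF _ c2]) (rule linearI; simp add: bilinear_simps)
    show "v \<bullet> (g x *v v) > 0" if "v \<noteq> 0" for v
      using ak U(2) that unfolding almost_kaehler_def riemannian_metric_def by blast
  qed (rule lin sym[OF U(2)] JJ[OF U(2)] skew[OF U(2)])+
qed

section \<open>Index formulas for the connection versus the one-jet\<close>

lemma (in almost_kaehler_jet) christoffel_eq_gamma:
  assumes "(g has_derivative dG) (at x)" "g x = G"
  shows "christoffel g x k i j = gamma (axis i 1) (axis j 1) $ k"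
  by (simp add: christoffel_def gamma_def gamma_lower_def matrix_vector_mult_def[of _ "vec_lambda _"] assms(2)
    partial_deriv_tensor_component[OF assms(1)] axis_inner_matrix_axis sum_divide_distrib)

lemma (in almost_kaehler_jet) gamma_J_axis:
  "gamma u (J *v v) = (\<Sum>l\<in>UNIV. (J *v v) $ l *\<^sub>R gamma u (axis l 1))"
  by (rule linear_axis_expansion[OF linear_gamma])

lemma almost_kaehler_derivatives:
  assumes "open U" "x \<in> U" "almost_kaehler U g J"
  shows "(g has_derivative frechet_derivative g (at x)) (at x)"
    and "(J has_derivative frechet_derivative J (at x)) (at x)"
  using assms by (auto simp: almost_kaehler_def riemannian_metric_def almost_complex_def
      intro!: smooth_tensor_has_derivative)

lemma
  assumes U: "open U" "x \<in> U" and ak: "almost_kaehler U g J"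
  shows nabla_endomorphism_eq_0_iff: "(\<forall>i k j. nabla_endomorphism g J x i k j = 0) \<longleftrightarrow>
    (\<forall>u v. nijenhuis_jet (J x) (frechet_derivative J (at x)) u v = 0)"
    and nabla_covariant_eq_0_iff: "(\<forall>i j k. nabla_covariant g (fundamental_form g J) x i j k = 0) \<longleftrightarrow>
    (\<forall>u v. nijenhuis_jet (J x) (frechet_derivative J (at x)) u v = 0)"
proof -
  let ?G = "g x" and ?J = "J x" and ?dG = "frechet_derivative g (at x)"
    and ?dJ = "frechet_derivative J (at x)"
  interpret almost_kaehler_jet ?G ?J ?dG ?dJ by (rule almost_kaehler_jet_at[OF assms])
  note d = almost_kaehler_derivatives[OF assms]
  note gam = christoffel_eq_gamma[OF d(1) refl]
  have axes: "(\<forall>u v. nabla_J u v = 0) \<longleftrightarrow> (\<forall>i j. nabla_J (axis i 1) (axis j 1) = 0)"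
    using linear_eq_0_axis[OF linear_nabla_J(1)] linear_eq_0_axis[OF linear_nabla_J(2)] by metis
  have "nabla_endomorphism g J x i k j = nabla_J (axis i 1) (axis j 1) $ k" for i k j
  proof -
    have "(?J *v gamma u v) $ k = (\<Sum>l\<in>UNIV. gamma u v $ l * ?J $ k $ l)" for u v
      by (simp add: matrix_vector_mult_def mult.commute)
    then show ?thesis
      by (simp add: nabla_endomorphism_def nabla_J_def gam gamma_J_axis[of "axis i 1" "axis j 1"] matrix_vector_axis_nth
        partial_deriv_tensor_component[OF d(2)] mult.commute)
  qed
  then show "(\<forall>i k j. nabla_endomorphism g J x i k j = 0) \<longleftrightarrow>
    (\<forall>u v. nijenhuis_jet ?J ?dJ u v = 0)"
    unfolding nijenhuis_jet_eq_0_iff axes by (auto simp: vec_eq_iff)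
  have "nabla_covariant g (fundamental_form g J) x i j k
      = nabla_J (axis i 1) (axis j 1) \<bullet> (?G *v axis k 1)" for i j k
  proof -
    have "((\<lambda>y. (J y *v u) \<bullet> (g y *v v)) has_derivative (\<lambda>h. domega h u v)) (at x)" for u v
      unfolding domega_def
      by (rule derivative_eq_intros has_derivative_matrix_vector d | simp add: add.commute)+
    then have p: "partial_deriv i (\<lambda>y. (J y *v axis j 1) \<bullet> (g y *v axis k 1)) x
        = domega (axis i 1) (axis j 1) (axis k 1)" for i j k
      by (rule partial_deriv_eq)
    \<comment> \<open>Expanding \<open>gamma\<close> in the coordinate basis, in either slot,
      produces the two index sums of \<open>nabla_covariant\<close>.\<close>
    have q1: "(?J *v u) \<bullet> (?G *v v) = (\<Sum>l\<in>UNIV. u $ l * ((?J *v axis l 1) \<bullet> (?G *v v)))"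
        for u v
      using linear_axis_expansion[of "\<lambda>u. (?J *v u) \<bullet> (?G *v v)" u]
      by (simp add: linear_iff matrix_vector_right_distrib matrix_vector_mult_scaleR inner_add_left)
    have q2: "(?J *v u) \<bullet> (?G *v v) = (\<Sum>l\<in>UNIV. v $ l * ((?J *v u) \<bullet> (?G *v axis l 1)))"
        for u v
      using linear_axis_expansion[of "\<lambda>v. (?J *v u) \<bullet> (?G *v v)" v]
      by (simp add: linear_iff matrix_vector_right_distrib matrix_vector_mult_scaleR inner_add_right)
    show ?thesis
      unfolding nabla_omega[symmetric] nabla_covariant_def gam fundamental_form_inner p
      by (simp only: q1[of "gamma (axis i 1) (axis j 1)"] q2[of _ "gamma (axis i 1) (axis k 1)"])
  qed
  moreover have "nabla_J u v = 0 \<longleftrightarrow> (\<forall>k. nabla_J u v \<bullet> (?G *v axis k 1) = 0)" for u v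
  proof
    assume *: "\<forall>k. nabla_J u v \<bullet> (?G *v axis k 1) = 0"
    have "linear (\<lambda>w. nabla_J u v \<bullet> (?G *v w))"
      by (simp add: linear_iff matrix_vector_right_distrib matrix_vector_mult_scaleR inner_add_right)
    then show "nabla_J u v = 0"
      using * G_nondegenerate linear_eq_0_axis by blast
  qed simp
  ultimately show "(\<forall>i j k. nabla_covariant g (fundamental_form g J) x i j k = 0) \<longleftrightarrow>
    (\<forall>u v. nijenhuis_jet ?J ?dJ u v = 0)"
    unfolding nijenhuis_jet_eq_0_iff axes by auto
qed

lemma nijenhuis_eq_jet:
  assumes J: "(J has_derivative dJ) (at x)" and X: "(X has_derivative X') (at x)"
    and Y: "(Y has_derivative Y') (at x)" and JJ: "\<And>v. J x *v (J x *v v) = - v"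
  shows "nijenhuis J X Y x = nijenhuis_jet (J x) dJ (X x) (Y x)"
proof -
  note d = has_derivative_matrix_vector[OF J X] has_derivative_matrix_vector[OF J Y] X Y
  note fd = d[THEN frechet_derivative_at, symmetric]
  show ?thesis
    by (simp add: nijenhuis_def lie_bracket_def fd nijenhuis_jet_def Let_def JJ
      matrix_vector_right_distrib matrix_vector_mult_diff_distrib)
qed

lemma integrable_J_iff:
  assumes U: "open U" and J: "almost_complex U J"
  shows "integrable_J U J \<longleftrightarrow>
    (\<forall>x\<in>U. \<forall>u v. nijenhuis_jet (J x) (frechet_derivative J (at x)) u v = 0)"
proof -
  have N: "nijenhuis J X Y x = nijenhuis_jet (J x) (frechet_derivative J (at x)) (X x) (Y x)"
    if "x \<in> U" "smooth_on U X" "smooth_on U Y" for X Y x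
    by (rule nijenhuis_eq_jet[OF smooth_tensor_has_derivative smooth_on_has_derivative
          smooth_on_has_derivative])
      (use J that U in \<open>auto simp: almost_complex_def\<close>)
  show ?thesis
  proof
    assume I: "integrable_J U J"
    show "\<forall>x\<in>U. \<forall>u v. nijenhuis_jet (J x) (frechet_derivative J (at x)) u v = 0"
    proof (intro ballI allI)
      fix x u v assume "x \<in> U"
      then show "nijenhuis_jet (J x) (frechet_derivative J (at x)) u v = 0"
        \<comment> \<open>Constant fields realize any prescribed pair of vectors at
          \<open>x\<close>.\<close>
        using I N[of x "\<lambda>_. u" "\<lambda>_. v"] by (simp add: integrable_J_def smooth_on_const)
    qed
  qed (simp add: integrable_J_def N)
qed

proposition almost_kaehler_parallel_iff_integrable:
  assumes "open U" "almost_kaehler U g J"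
  shows "parallel_form U g (fundamental_form g J) \<longleftrightarrow> integrable_J U J"
    and "parallel_endomorphism U g J \<longleftrightarrow> integrable_J U J"
  using assms(2) nabla_endomorphism_eq_0_iff[OF assms(1) _ assms(2)]
    nabla_covariant_eq_0_iff[OF assms(1) _ assms(2)]
  by (auto simp: integrable_J_iff[OF assms(1)] almost_kaehler_def parallel_form_def
    parallel_endomorphism_def)


section \<open>Leafwise holomorphic functions of a coordinate plane distribution\<close>

definition plane_param :: "4 \<Rightarrow> 4 \<Rightarrow> real^2 \<Rightarrow> real^4" where
  "plane_param p q w = w $ 1 *\<^sub>R coord_field p + w $ 2 *\<^sub>R coord_field q"

lemma bounded_linear_plane_param: "bounded_linear (plane_param p q)"
  unfolding plane_param_def
  by (intro bounded_linear_add bounded_linear_compose[OF bounded_linear_scaleR_left]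
      bounded_linear_vec_nth)

lemma range_plane_param: "range (plane_param p q) = span {coord_field p, coord_field q}"
proof
  show "range (plane_param p q) \<subseteq> span {coord_field p, coord_field q}"
    by (auto simp: plane_param_def intro!: span_add span_scale intro: span_base)
  show "span {coord_field p, coord_field q} \<subseteq> range (plane_param p q)"
  proof (rule span_minimal)
    have "coord_field p = plane_param p q (vector [1, 0])"
      "coord_field q = plane_param p q (vector [0, 1])"
      by (simp_all add: plane_param_def)
    then show "{coord_field p, coord_field q} \<subseteq> range (plane_param p q)"
      by (metis empty_subsetI insert_subset rangeI)
    show "subspace (range (plane_param p q))"
      using bounded_linear.linear[OF bounded_linear_plane_param] linear_subspace_image subspace_UNIV
      by blast
  qed
qed

lemma plane_param_nth:
  assumes "p \<noteq> q"
  shows "plane_param p q w $ p = w $ 1" and "plane_param p q w $ q = w $ 2"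
    and "i \<noteq> p \<Longrightarrow> i \<noteq> q \<Longrightarrow> plane_param p q w $ i = 0"
  using assms by (auto simp: plane_param_def axis_def)

lemma inj_plane_param: "p \<noteq> q \<Longrightarrow> inj (plane_param p q)"
  by (rule injI) (simp add: vec_eq_iff forall_2 plane_param_nth(1,2)[symmetric])

lemma span_coord_fields_iff:
  fixes p q :: 4
  assumes "p \<noteq> q"
  shows "v \<in> span {coord_field p, coord_field q} \<longleftrightarrow> (\<forall>i. i \<noteq> p \<longrightarrow> i \<noteq> q \<longrightarrow> v $ i = 0)"
proof
  assume v: "\<forall>i. i \<noteq> p \<longrightarrow> i \<noteq> q \<longrightarrow> v $ i = 0"
  let ?w = "vector [v $ p, v $ q] :: real^2"
  have "v $ i = plane_param p q ?w $ i" for i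
  proof (cases "i = p \<or> i = q")
    case True
    then show ?thesis using plane_param_nth(1,2)[OF assms, of ?w] by fastforce
  next
    case False
    then have "v $ i = 0" using v by blast
    with False show ?thesis using plane_param_nth(3)[OF assms, of i ?w] by simp
  qed
  then have "v = plane_param p q ?w" unfolding vec_eq_iff by blast
  then show "v \<in> span {coord_field p, coord_field q}"
    unfolding range_plane_param[symmetric] by (rule range_eqI)
next
  assume "v \<in> span {coord_field p, coord_field q}"
  then obtain w where "v = plane_param p q w"
    unfolding range_plane_param[symmetric] by blast
  then show "\<forall>i. i \<noteq> p \<longrightarrow> i \<noteq> q \<longrightarrow> v $ i = 0"
    using plane_param_nth(3)[OF assms] by blast
qed

lemma has_derivative_plane_chart:
  "((\<lambda>w. x + plane_param p q w) has_derivative plane_param p q) (at w)"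
  by (auto intro!: derivative_eq_intros bounded_linear_imp_has_derivative[OF bounded_linear_plane_param])

lemma frechet_derivative_plane_chart:
  "frechet_derivative (\<lambda>w. x + plane_param p q w) (at w) = plane_param p q"
  by (rule frechet_derivative_at[OF has_derivative_plane_chart, symmetric])

text \<open>Invariance of domain applies to the leaf chart followed by the projection to the plane.\<close>

lemma leaf_chart_open_in_plane:
  fixes x :: "real^4"
  assumes "p \<noteq> q" and t: "leaf_chart U (\<lambda>_. span {coord_field p, coord_field q}) W t"
  shows "open {w. x + plane_param p q w \<in> t ` W}"
proof (subst open_subopen, intro ballI)
  fix w0 assume "w0 \<in> {w. x + plane_param p q w \<in> t ` W}"
  then obtain w1 where w1: "w1 \<in> W" "x + plane_param p q w0 = t w1" by auto
  have W: "open W" and inj: "inj_on t W" and sm: "smooth_on W t"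
    using t by (auto simp: leaf_chart_def)
  have rng: "range (frechet_derivative t (at w)) = range (plane_param p q)" if "w \<in> W" for w
    using t that by (auto simp: leaf_chart_def range_plane_param)
  obtain r where r: "r > 0" "ball w1 r \<subseteq> W"
    using W w1(1) by (auto simp: open_contains_ball)
  have d: "(t has_derivative frechet_derivative t (at w)) (at w)" if "w \<in> ball w1 r" for w
    by (rule smooth_on_has_derivative[OF sm W]) (use r(2) that in blast)
  \<comment> \<open>The derivative of \<open>t\<close> takes values in the plane, so the other
    coordinates have zero derivative and are constant on the convex ball.\<close>
  have const: "t w $ i = t w1 $ i" if "w \<in> ball w1 r" "i \<noteq> p" "i \<noteq> q" for w i
  proof -
    have d0: "((\<lambda>w. t w $ i) has_derivative (\<lambda>h. 0)) (at w within ball w1 r)"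
      if w: "w \<in> ball w1 r" for w
    proof -
      have "frechet_derivative t (at w) h $ i = 0" for h
      proof -
        have "frechet_derivative t (at w) h \<in> range (plane_param p q)"
          using rng[of w] r(2) w by blast
        then show ?thesis
          using plane_param_nth(3)[OF assms(1) \<open>i \<noteq> p\<close> \<open>i \<noteq> q\<close>] by auto
      qed
      then show ?thesis
        using bounded_linear.has_derivative[OF bounded_linear_vec_nth[of i] d[OF w]]
        by (simp add: has_derivative_at_withinI)
    qed
    have "\<exists>c. \<forall>w\<in>ball w1 r. t w $ i = c"
      using d0 by (intro has_derivative_zero_constant[where f="\<lambda>w. t w $ i"] convex_ball) auto
    then obtain c where "\<And>w. w \<in> ball w1 r \<Longrightarrow> t w $ i = c" by blast
    then show ?thesis using that(1) r(1) by simp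
  qed
  \<comment> \<open>The projection forgets only coordinates that \<open>t\<close> keeps constant on
    the ball, so \<open>t\<close> followed by it stays injective, now between spaces of equal
    dimension.\<close>
  define \<pi> where "\<pi> v = (\<chi> k::2. if k = 1 then v $ p else v $ q)" for v :: "real^4"
  have \<pi>_eq: "\<pi> v = \<pi> v' \<longleftrightarrow> v $ p = v' $ p \<and> v $ q = v' $ q" for v v'
    by (auto simp: \<pi>_def vec_eq_iff forall_2)
  have \<pi>_plane: "\<pi> (x + plane_param p q w) = \<pi> x + w" for w
    using plane_param_nth[OF assms(1)] by (simp add: \<pi>_def vec_eq_iff forall_2)
  have inj_\<pi>t: "inj_on (\<lambda>w. \<pi> (t w)) (ball w1 r)"
  proof (rule inj_onI)
    fix v w assume vw: "v \<in> ball w1 r" "w \<in> ball w1 r" "\<pi> (t v) = \<pi> (t w)"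
    have "t v $ i = t w $ i" for i
      using iffD1[OF \<pi>_eq vw(3)] const[OF vw(1), of i] const[OF vw(2), of i] by metis
    then have "t v = t w" by (simp add: vec_eq_iff)
    then show "v = w" using inj vw r(2) by (meson inj_onD subsetD)
  qed
  have cont_\<pi>t: "continuous_on (ball w1 r) (\<lambda>w. \<pi> (t w))"
  proof -
    have "continuous_on (ball w1 r) t"
      by (intro continuous_at_imp_continuous_on ballI has_derivative_continuous[OF d])
    then have "continuous_on (ball w1 r) (\<lambda>w. if k = (1::2) then t w $ p else t w $ q)" for k
      by (cases "k = 1") (auto intro: continuous_on_component)
    then show ?thesis unfolding \<pi>_def by (rule continuous_on_vec_lambda)
  qed
  have op: "open ((\<lambda>w. \<pi> (t w)) ` ball w1 r)"
    by (rule invariance_of_domain[OF cont_\<pi>t open_ball inj_\<pi>t])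
  show "\<exists>T. open T \<and> w0 \<in> T \<and> T \<subseteq> {w. x + plane_param p q w \<in> t ` W}"
  proof (intro exI conjI subsetI)
    show "open ((\<lambda>w. \<pi> x + w) -` ((\<lambda>w. \<pi> (t w)) ` ball w1 r))"
      by (intro open_vimage op continuous_intros)
    show "w0 \<in> (\<lambda>w. \<pi> x + w) -` ((\<lambda>w. \<pi> (t w)) ` ball w1 r)"
      using r(1) by (simp add: \<pi>_plane[symmetric] w1(2))
    fix w assume "w \<in> (\<lambda>w. \<pi> x + w) -` ((\<lambda>w. \<pi> (t w)) ` ball w1 r)"
    then obtain w' where w': "w' \<in> ball w1 r" "\<pi> x + w = \<pi> (t w')" by auto
    \<comment> \<open>In the plane directions the projections agree; in the others both points share
      the coordinates of \<open>t w1\<close>, which lies on the plaque.\<close>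
    have "(x + plane_param p q w) $ i = t w' $ i" for i
    proof (cases "i = p \<or> i = q")
      case True
      then show ?thesis using w'(2) unfolding \<pi>_plane[symmetric] \<pi>_eq by auto
    next
      case False
      then have "t w' $ i = (x + plane_param p q w0) $ i" using const[OF w'(1)] w1(2) by simp
      with False show ?thesis using plane_param_nth(3)[OF assms(1)] by simp
    qed
    then have "x + plane_param p q w = t w'" by (simp add: vec_eq_iff)
    then show "w \<in> {w. x + plane_param p q w \<in> t ` W}" using w'(1) r(2) by auto
  qed
qed

text \<open>The plaque is the image of a ball under a map continuous into the leaf topology, where
  only preimages of generating sets need checking. It is thus connected and lies in the component of
  \<open>x\<close>.\<close>

lemma plane_chart_in_leaf:
  assumes "p \<noteq> q" "open U" "x \<in> U"
  defines "D \<equiv> \<lambda>_. span {coord_field p, coord_field q}"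
  obtains r L where "r > 0" "leaf_chart U D (ball 0 r) (\<lambda>w. x + plane_param p q w)"
    "L \<in> leaves U D" "(\<lambda>w. x + plane_param p q w) ` ball 0 r \<subseteq> L"
proof -
  let ?s = "\<lambda>w. x + plane_param p q w"
  have cont: "continuous_on UNIV ?s"
    by (intro continuous_at_imp_continuous_on ballI
        has_derivative_continuous[OF has_derivative_plane_chart])
  have "plane_param p q 0 = 0" by (simp add: plane_param_def)
  then have "open (?s -` U)" "0 \<in> ?s -` U"
    using assms(2,3) by (auto intro!: open_vimage cont)
  then obtain r where r: "r > 0" "ball 0 r \<subseteq> ?s -` U"
    by (rule openE)
  have "inj_on ?s (ball 0 r)"
    using inj_plane_param[OF assms(1)] by (auto simp: inj_on_def)
  then have chart: "leaf_chart U D (ball 0 r) ?s"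
    unfolding leaf_chart_def D_def frechet_derivative_plane_chart range_plane_param[symmetric]
    using r(2) inj_plane_param[OF assms(1)] smooth_on_affine[OF bounded_linear_plane_param] by blast
  let ?X = "leaf_topology U D"
  have "continuous_map (top_of_set (ball 0 r)) ?X ?s"
    unfolding leaf_topology_def
  proof (rule continuous_on_generated_topo)
    fix T assume "T \<in> {t ` W |W t. leaf_chart U D W t}"
    then have "open {w. ?s w \<in> T}"
      using leaf_chart_open_in_plane[OF assms(1)] by (auto simp: D_def)
    moreover have "?s -` T = {w. ?s w \<in> T}" by auto
    ultimately show "openin (top_of_set (ball 0 r)) (?s -` T \<inter> topspace (top_of_set (ball 0 r)))"
      by (metis Int_commute openin_open_Int topspace_euclidean_subtopology)
  next
    show "?s ` topspace (top_of_set (ball 0 r)) \<subseteq> \<Union> {t ` W |W t. leaf_chart U D W t}"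
      using chart by auto
  qed
  then have con: "connectedin ?X (?s ` ball 0 r)"
    by (rule connectedin_continuous_map_image) (simp add: connectedin_subtopology)
  have x: "x \<in> ?s ` ball 0 r"
    using \<open>plane_param p q 0 = 0\<close> r(1) by (auto intro!: image_eqI[of _ _ 0])
  have "?s ` ball 0 r \<subseteq> connected_component_of_set ?X x"
    by (rule connected_component_of_maximal[OF con x])
  moreover have "x \<in> topspace ?X"
    using connectedin_subset_topspace[OF con] x by (rule subsetD)
  ultimately show thesis
    using that[OF r(1) chart, of "connected_component_of_set ?X x"]
    by (simp add: leaves_def connected_components_of_def)
qed

lemma has_derivative_Complex:
  assumes "(f has_derivative f') F" "(h has_derivative h') F"
  shows "((\<lambda>x. Complex (f x) (h x)) has_derivative (\<lambda>v. Complex (f' v) (h' v))) F"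
  unfolding Complex_eq using assms by (auto intro!: derivative_eq_intros)

text \<open>Pointwise necessity is tested at the centre of a plaque. Conversely the chain rule
  carries the pointwise condition to every chart, whose tangent planes are the given plane.\<close>

lemma leafwise_holomorphic_iff:
  assumes "p \<noteq> q" "open U"
    and \<phi>: "\<And>x. x \<in> U \<Longrightarrow> (\<phi> has_derivative \<phi>' x) (at x)"
    and inv: "\<And>x v. x \<in> U \<Longrightarrow> v \<in> span {coord_field p, coord_field q} \<Longrightarrow>
      J x *v v \<in> span {coord_field p, coord_field q}"
  shows "leafwise_holomorphic U J (\<lambda>_. span {coord_field p, coord_field q}) \<phi> \<longleftrightarrow>
    (\<forall>x\<in>U. \<forall>v\<in>span {coord_field p, coord_field q}. \<phi>' x (J x *v v) = \<i> * \<phi>' x v)"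
    (is "?L \<longleftrightarrow> ?R")
proof
  assume hol: ?L
  show ?R
  proof (intro ballI)
    fix x v assume x: "x \<in> U" and v: "v \<in> span {coord_field p, coord_field q}"
    let ?s = "\<lambda>w. x + plane_param p q w"
    obtain r L where r: "r > 0"
      "leaf_chart U (\<lambda>_. span {coord_field p, coord_field q}) (ball 0 r) ?s"
      "L \<in> leaves U (\<lambda>_. span {coord_field p, coord_field q})" "?s ` ball 0 r \<subseteq> L"
      using plane_chart_in_leaf[OF assms(1,2) x] by blast
    obtain u u' where u: "v = plane_param p q u" "J x *v v = plane_param p q u'"
      using v inv[OF x v] by (auto simp flip: range_plane_param)
    have s0: "?s 0 = x" by (simp add: plane_param_def)
    have d\<phi>: "frechet_derivative (\<phi> \<circ> ?s) (at 0) = \<phi>' x \<circ> plane_param p q"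
      using diff_chain_at[OF has_derivative_plane_chart[of x p q 0], of \<phi> "\<phi>' x"] \<phi>[OF x]
      unfolding s0 by (intro frechet_derivative_at[symmetric])
    have "frechet_derivative (\<phi> \<circ> ?s) (at 0) u' = \<i> * frechet_derivative (\<phi> \<circ> ?s) (at 0) u"
    proof -
      have "0 \<in> ball (0::real^2) r" using r(1) by simp
      moreover have "frechet_derivative ?s (at 0) u' = J (?s 0) *v frechet_derivative ?s (at 0) u"
        by (simp only: frechet_derivative_plane_chart s0 u(2) flip: u(1))
      ultimately show ?thesis
        using hol r(2-4) unfolding leafwise_holomorphic_def by blast
    qed
    then show "\<phi>' x (J x *v v) = \<i> * \<phi>' x v"
      by (simp only: d\<phi> u(2) comp_apply flip: u(1))
  qed
next
  assume R: ?R
  show ?L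
    unfolding leafwise_holomorphic_def
  proof (intro ballI allI impI)
    fix L W and s :: "real^2 \<Rightarrow> real^4" and w
    assume "leaf_chart U (\<lambda>_. span {coord_field p, coord_field q}) W s \<and> s ` W \<subseteq> L"
      and w: "w \<in> W"
    then have s: "smooth_on W s" "open W" "s w \<in> U"
      "range (frechet_derivative s (at w)) = span {coord_field p, coord_field q}"
      by (auto simp: leaf_chart_def)
    have d: "(\<phi> \<circ> s has_derivative \<phi>' (s w) \<circ> frechet_derivative s (at w)) (at w)"
      by (rule diff_chain_at[OF smooth_on_has_derivative[OF s(1,2) w] \<phi>[OF s(3)]])
    have "\<phi>' (s w) (J (s w) *v frechet_derivative s (at w) u)
        = \<i> * \<phi>' (s w) (frechet_derivative s (at w) u)" for u
      using R s(3,4) by blast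
    with d show "\<phi> \<circ> s differentiable at w \<and> (\<forall>u u'. frechet_derivative s (at w) u' =
        J (s w) *v frechet_derivative s (at w) u \<longrightarrow>
        frechet_derivative (\<phi> \<circ> s) (at w) u' = \<i> * frechet_derivative (\<phi> \<circ> s) (at w) u)"
      by (auto simp: differentiable_def frechet_derivative_at[OF d, symmetric])
  qed
qed

text \<open>The real part of the condition is \<open>a (J v) = - b v\<close>; putting
  \<open>J v\<close> for \<open>v\<close> gives the imaginary part. By linearity the real part need
  only be tested on the two spanning fields.\<close>

lemma cauchy_riemann_on_plane:
  fixes a b :: "real^4 \<Rightarrow> real" and J :: "real^4^4"
  assumes "linear a" "linear b" and JJ: "\<And>v. J *v (J *v v) = - v"
    and inv: "\<And>v. v \<in> span {coord_field p, coord_field q} \<Longrightarrow>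
      J *v v \<in> span {coord_field p, coord_field q}"
  shows "(\<forall>v\<in>span {coord_field p, coord_field q}.
      Complex (a (J *v v)) (b (J *v v)) = \<i> * Complex (a v) (b v)) \<longleftrightarrow>
    a (J *v coord_field p) = - b (coord_field p) \<and> a (J *v coord_field q) = - b (coord_field q)"
    (is "?L \<longleftrightarrow> ?R")
proof
  assume ?L
  then show ?R by (simp add: span_base complex_eq_iff)
next
  assume R: ?R
  have ab: "a (J *v v) = - b v" if v: "v \<in> span {coord_field p, coord_field q}" for v
  proof -
    obtain u where "v = plane_param p q u" using v unfolding range_plane_param[symmetric] by blast
    then show ?thesis
      using R assms(1,2) by (simp add: plane_param_def matrix_vector_right_distrib
        matrix_vector_mult_scaleR linear_add linear_scale)
  qed
  show ?L
  proof
    fix v assume v: "v \<in> span {coord_field p, coord_field q}"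
    have "b (J *v v) = a v"
      using ab[OF inv[OF v]] assms(1) by (simp add: JJ linear_neg)
    with ab[OF v] show "Complex (a (J *v v)) (b (J *v v)) = \<i> * Complex (a v) (b v)"
      by (simp add: complex_eq_iff)
  qed
qed


section \<open>The block metric\<close>

lemma vector_4:
  "(vector [a, b, c, d] :: 'a::zero^4) $ 1 = a"
  "(vector [a, b, c, d] :: 'a::zero^4) $ 2 = b"
  "(vector [a, b, c, d] :: 'a::zero^4) $ 3 = c"
  "(vector [a, b, c, d] :: 'a::zero^4) $ 4 = d"
  unfolding vector_def by simp_all

lemma quadratic_form_unimodular:
  fixes a b c u v :: real
  assumes "a > 0" "a * c - b\<^sup>2 = 1"
  shows "a * u\<^sup>2 + 2 * b * u * v + c * v\<^sup>2 \<ge> 0"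
    and "u \<noteq> 0 \<or> v \<noteq> 0 \<Longrightarrow> a * u\<^sup>2 + 2 * b * u * v + c * v\<^sup>2 > 0"
proof -
  let ?Q = "a * u\<^sup>2 + 2 * b * u * v + c * v\<^sup>2"
  \<comment> \<open>Completing the square.\<close>
  have "a * ?Q = (a * u + b * v)\<^sup>2 + (a * c - b\<^sup>2) * v\<^sup>2"
    by (simp add: power2_eq_square algebra_simps)
  then have aQ: "a * ?Q = (a * u + b * v)\<^sup>2 + v\<^sup>2"
    by (simp add: assms(2))
  then have "a * ?Q \<ge> 0" by simp
  then show "?Q \<ge> 0" using assms(1) by (simp only: zero_le_mult_iff) auto
  assume "u \<noteq> 0 \<or> v \<noteq> 0"
  then have "a * ?Q > 0"
    unfolding aQ using assms(1) by (cases "v = 0") (auto intro: add_nonneg_pos)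
  then show "?Q > 0" using assms(1) by (simp only: zero_less_mult_iff) auto
qed

text \<open>
  With \<open>s = sec \<alpha>\<close>, \<open>t = tan \<alpha>\<close>, \<open>S = sec \<gamma>\<close>, \<open>T = tan \<gamma>\<close>, \<open>E = exp \<beta>\<close>, \<open>F = exp \<delta>\<close>
  and with \<open>p\<^sub>k, q\<^sub>k\<close> the derivatives of \<open>\<alpha>, \<beta>\<close>, the left-hand side is the vanishing of two
  components of the Nijenhuis tensor on \<open>\<partial>\<^sub>1, \<partial>\<^sub>3\<close>.
\<close>

lemma block_equations:
  fixes s t S T E E' F F' p3 p4 q3 q4 :: real
  assumes s: "s\<^sup>2 = 1 + t\<^sup>2" and S: "S\<^sup>2 = 1 + T\<^sup>2"
    and E: "E * E' = 1" and F: "F * F' = 1"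
  defines "a3 \<equiv> E' * s * (t * p3 - q3)" and "a4 \<equiv> E' * s * (t * p4 - q4)"
    and "b3 \<equiv> p3 * s\<^sup>2" and "b4 \<equiv> p4 * s\<^sup>2"
  shows "T * b3 - F' * S * b4 = t * b3 - E * s * a3 \<and> T * a3 - F' * S * a4 = E' * s * b3 - t * a3 \<longleftrightarrow>
    - q3 = p4 * F' * S - p3 * T \<and> q4 = p3 * F * S - p4 * T"
proof -
  have nz: "s \<noteq> 0" "S \<noteq> 0" "E' \<noteq> 0" "F' \<noteq> 0"
    using assms(1-4) by (auto simp: power2_eq_square) (metis add_pos_nonneg less_irrefl zero_le_square zero_less_one)+
  have "T * b3 - F' * S * b4 - (t * b3 - E * s * a3)
      = s\<^sup>2 * (T * p3 - F' * S * p4 - t * p3 + (E * E') * (t * p3 - q3))"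
    unfolding a3_def b3_def b4_def by (simp add: power2_eq_square algebra_simps)
  also have "\<dots> = s\<^sup>2 * (- q3 - (p4 * F' * S - p3 * T))"
    by (simp add: E algebra_simps)
  finally have 1: "T * b3 - F' * S * b4 = t * b3 - E * s * a3 \<longleftrightarrow> - q3 = p4 * F' * S - p3 * T"
    using nz(1) by (metis eq_iff_diff_eq_0 mult_eq_0_iff power_eq_0_iff)
  \<comment> \<open>This equivalence is modulo the first equation: once \<open>q3\<close> is
    substituted, the terms in \<open>t\<close> cancel through
    \<open>s\<^sup>2 = 1 + t\<^sup>2\<close>.\<close>
  have 2: "T * a3 - F' * S * a4 = E' * s * b3 - t * a3 \<longleftrightarrow> q4 = p3 * F * S - p4 * T"
    if q3: "- q3 = p4 * F' * S - p3 * T"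
  proof -
    have q3': "q3 = p3 * T - p4 * F' * S" using q3 by simp
    have "T * a3 - F' * S * a4 - (E' * s * b3 - t * a3)
        = E' * s * (T * (t * p3 - q3) - F' * S * (t * p4 - q4) + t * (t * p3 - q3) - p3 * s\<^sup>2)"
      unfolding a3_def a4_def b3_def by (simp add: power2_eq_square algebra_simps)
    also have "\<dots> = E' * s * (F' * S * q4 + F' * S * p4 * T - p3 * (1 + T\<^sup>2))"
      unfolding s q3' by (simp add: power2_eq_square algebra_simps)
    also have "\<dots> = E' * s * (F' * S * q4 + F' * S * p4 * T - (F * F') * p3 * S\<^sup>2)"
      unfolding F S by simp
    also have "\<dots> = (E' * s * F' * S) * (q4 - (p3 * F * S - p4 * T))"
      by (simp add: power2_eq_square algebra_simps)
    finally show ?thesis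
      using nz by (metis eq_iff_diff_eq_0 mult_eq_0_iff)
  qed
  show ?thesis using 1 2 by blast
qed

lemma has_derivative_block_components:
  assumes "(\<alpha> has_derivative \<alpha>') (at x)" "(\<beta> has_derivative \<beta>') (at x)" "cos (\<alpha> x) \<noteq> 0"
  shows "((\<lambda>y. exp (- \<beta> y) * sec (\<alpha> y)) has_derivative
      (\<lambda>h. exp (- \<beta> x) * sec (\<alpha> x) * (tan (\<alpha> x) * \<alpha>' h - \<beta>' h))) (at x)"
    and "((\<lambda>y. tan (\<alpha> y)) has_derivative (\<lambda>h. \<alpha>' h * (sec (\<alpha> x))\<^sup>2)) (at x)"
proof -
  show "((\<lambda>y. exp (- \<beta> y) * sec (\<alpha> y)) has_derivative
      (\<lambda>h. exp (- \<beta> x) * sec (\<alpha> x) * (tan (\<alpha> x) * \<alpha>' h - \<beta>' h))) (at x)"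
    by (rule derivative_eq_intros assms refl | simp add: assms)+
      (simp add: fun_eq_iff tan_def field_simps power2_eq_square assms)
  show "((\<lambda>y. tan (\<alpha> y)) has_derivative (\<lambda>h. \<alpha>' h * (sec (\<alpha> x))\<^sup>2)) (at x)"
    using has_derivative_tan[OF assms(3,1)] by (simp add: power_divide inverse_eq_divide)
qed

locale block_metric =
  fixes U :: "(real ^ 4) set" and \<alpha> \<beta> \<gamma> \<delta> :: "real ^ 4 \<Rightarrow> real"
  assumes open_U: "open U"
    and smooth_\<alpha>: "smooth_on U \<alpha>" and smooth_\<beta>: "smooth_on U \<beta>"
    and smooth_\<gamma>: "smooth_on U \<gamma>" and smooth_\<delta>: "smooth_on U \<delta>"
    and range_\<alpha>: "\<alpha> ` U \<subseteq> {- pi / 2 <..< pi / 2}" and range_\<gamma>: "\<gamma> ` U \<subseteq> {- pi / 2 <..< pi / 2}"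
begin

abbreviation "g \<equiv> metric_M \<alpha> \<beta> \<gamma> \<delta>"
abbreviation "J \<equiv> acs_J g"
abbreviation "\<omega> \<equiv> fundamental_form g J"
abbreviation "DJ x \<equiv> frechet_derivative J (at x)"

lemma g_nth:
  "g x $ 1 $ 1 = exp (- \<beta> x) * sec (\<alpha> x)" "g x $ 1 $ 2 = tan (\<alpha> x)" "g x $ 1 $ 3 = 0" "g x $ 1 $ 4 = 0"
  "g x $ 2 $ 1 = tan (\<alpha> x)" "g x $ 2 $ 2 = exp (\<beta> x) * sec (\<alpha> x)" "g x $ 2 $ 3 = 0" "g x $ 2 $ 4 = 0"
  "g x $ 3 $ 1 = 0" "g x $ 3 $ 2 = 0" "g x $ 3 $ 3 = exp (- \<delta> x) * sec (\<gamma> x)" "g x $ 3 $ 4 = tan (\<gamma> x)"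
  "g x $ 4 $ 1 = 0" "g x $ 4 $ 2 = 0" "g x $ 4 $ 3 = tan (\<gamma> x)" "g x $ 4 $ 4 = exp (\<delta> x) * sec (\<gamma> x)"
  by (simp_all only: metric_M_def vector_4)

lemma J_nth:
  "J x $ 1 $ 1 = - (g x $ 1 $ 2)" "J x $ 1 $ 2 = - (g x $ 2 $ 2)" "J x $ 1 $ 3 = 0" "J x $ 1 $ 4 = 0"
  "J x $ 2 $ 1 = g x $ 1 $ 1" "J x $ 2 $ 2 = g x $ 1 $ 2" "J x $ 2 $ 3 = 0" "J x $ 2 $ 4 = 0"
  "J x $ 3 $ 1 = 0" "J x $ 3 $ 2 = 0" "J x $ 3 $ 3 = - (g x $ 3 $ 4)" "J x $ 3 $ 4 = - (g x $ 4 $ 4)"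
  "J x $ 4 $ 1 = 0" "J x $ 4 $ 2 = 0" "J x $ 4 $ 3 = g x $ 3 $ 3" "J x $ 4 $ 4 = g x $ 3 $ 4"
  by (simp_all only: acs_J_def vector_4)

lemma cos_pos: assumes "x \<in> U" shows "cos (\<alpha> x) > 0" "cos (\<gamma> x) > 0"
  using range_\<alpha> range_\<gamma> assms by (auto intro!: cos_gt_zero_pi)

lemma sec_sq:
  assumes "x \<in> U"
  shows "(sec (\<alpha> x))\<^sup>2 = 1 + (tan (\<alpha> x))\<^sup>2" "(sec (\<gamma> x))\<^sup>2 = 1 + (tan (\<gamma> x))\<^sup>2"
  using cos_pos[OF assms] tan_sec[of "\<alpha> x"] tan_sec[of "\<gamma> x"]
  by (simp_all add: inverse_eq_divide power_divide)

lemma g_blocks: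
  assumes "x \<in> U"
  shows "g x $ 1 $ 1 > 0" "g x $ 3 $ 3 > 0" "g x $ 2 $ 1 = g x $ 1 $ 2" "g x $ 4 $ 3 = g x $ 3 $ 4"
    and "g x $ 1 $ 1 * g x $ 2 $ 2 - (g x $ 1 $ 2)\<^sup>2 = 1"
    and "g x $ 3 $ 3 * g x $ 4 $ 4 - (g x $ 3 $ 4)\<^sup>2 = 1"
proof -
  have e: "exp (- y) * s * (exp y * s) = s\<^sup>2" for y s :: real
    using exp_minus_inverse[of y] by (simp add: power2_eq_square mult.assoc mult.left_commute)
  show "g x $ 1 $ 1 * g x $ 2 $ 2 - (g x $ 1 $ 2)\<^sup>2 = 1"
    and "g x $ 3 $ 3 * g x $ 4 $ 4 - (g x $ 3 $ 4)\<^sup>2 = 1"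
    unfolding g_nth e sec_sq[OF assms] by simp_all
qed (use cos_pos[OF assms] in \<open>simp_all add: g_nth\<close>)

lemmas smooth_intros = smooth_on_const smooth_\<alpha> smooth_\<beta> smooth_\<gamma> smooth_\<delta>
  smooth_on_uminus[OF open_U] smooth_on_exp[OF open_U] smooth_on_sin[OF open_U]
  smooth_on_cos[OF open_U] smooth_on_mult[OF open_U] smooth_on_inverse[OF open_U]

lemma smooth_g: "smooth_on U (\<lambda>x. g x $ i $ j)"
proof -
  have "\<forall>i j. smooth_on U (\<lambda>x. g x $ i $ j)"
    unfolding forall_4 g_nth tan_def divide_inverse
    by (intro conjI smooth_intros) (auto dest: cos_pos)
  then show ?thesis by blast
qed

lemma smooth_J: "smooth_tensor U J"
  unfolding smooth_tensor_def forall_4 J_nth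
  by (intro conjI smooth_intros smooth_g)

lemma matrix_vector_block:
  "(g x *v v) = vector [g x $ 1 $ 1 * v $ 1 + g x $ 1 $ 2 * v $ 2, g x $ 2 $ 1 * v $ 1 + g x $ 2 $ 2 * v $ 2,
     g x $ 3 $ 3 * v $ 3 + g x $ 3 $ 4 * v $ 4, g x $ 4 $ 3 * v $ 3 + g x $ 4 $ 4 * v $ 4]"
  "(J x *v v) = vector [- g x $ 1 $ 2 * v $ 1 - g x $ 2 $ 2 * v $ 2, g x $ 1 $ 1 * v $ 1 + g x $ 1 $ 2 * v $ 2,
     - g x $ 3 $ 4 * v $ 3 - g x $ 4 $ 4 * v $ 4, g x $ 3 $ 3 * v $ 3 + g x $ 3 $ 4 * v $ 4]"
  by (simp_all add: vec_eq_iff forall_4 vector_4 matrix_vector_mult_def sum_4 J_nth g_nth(3,4,7-10,13,14))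

text \<open>Each block of \<open>J\<close> has trace 0 and determinant 1, so by Cayley-Hamilton its
  square is -1.\<close>

lemma J_J:
  assumes "x \<in> U"
  shows "J x *v (J x *v v) = - v"
proof -
  have 1: "g x $ 1 $ 1 * g x $ 2 $ 2 = 1 + g x $ 1 $ 2 * g x $ 1 $ 2"
    and 2: "g x $ 3 $ 3 * g x $ 4 $ 4 = 1 + g x $ 3 $ 4 * g x $ 3 $ 4"
    using g_blocks(5,6)[OF assms] by (simp_all add: power2_eq_square)
  have "a * (- b * u - c * v) + b * (a * u + b * v) = - v"
    "- b * (- b * u - c * v) - c * (a * u + b * v) = - u"
    if "a * c = 1 + b * b" for a b c u v :: real
    using arg_cong[OF that, of "\<lambda>z. z * v"] arg_cong[OF that, of "\<lambda>z. z * u"]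
    by (simp_all add: algebra_simps)
  from this[OF 1] this[OF 2] show ?thesis
    unfolding matrix_vector_block by (simp add: vec_eq_iff forall_4 vector_4)
qed

text \<open>The entries 1 are the block determinants \<open>g11 g22 - g12^2\<close> and
  \<open>g33 g44 - g34^2\<close>.\<close>

lemma omega_eq:
  assumes "x \<in> U"
  shows "\<omega> x = vector [vector [0, 1, 0, 0], vector [-1, 0, 0, 0],
    vector [0, 0, 0, 1], vector [0, 0, -1, 0]]"
  using g_blocks(3-6)[OF assms]
  by (simp add: fundamental_form_def vec_eq_iff forall_4 vector_4 sum_4 J_nth g_nth(3,4,7-10,13,14)
      power2_eq_square algebra_simps)

lemma almost_kaehler: "almost_kaehler U g J"
  unfolding almost_kaehler_def
proof (intro conjI)
  show "riemannian_metric U g"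
    unfolding riemannian_metric_def
  proof (intro conjI ballI allI impI)
    show "smooth_tensor U g" by (simp add: smooth_tensor_def smooth_g)
    fix x assume x: "x \<in> U"
    have "\<forall>i j. g x $ i $ j = g x $ j $ i"
      unfolding forall_4 g_nth by simp
    then show "g x $ i $ j = g x $ j $ i" for i j by blast
    fix v :: "real^4" assume "v \<noteq> 0"
    then have "(v $ 1 \<noteq> 0 \<or> v $ 2 \<noteq> 0) \<or> (v $ 3 \<noteq> 0 \<or> v $ 4 \<noteq> 0)"
      by (auto simp: vec_eq_iff forall_4)
    moreover note quadratic_form_unimodular[OF g_blocks(1,5)[OF x], of "v $ 1" "v $ 2"]
      quadratic_form_unimodular[OF g_blocks(2,6)[OF x], of "v $ 3" "v $ 4"]
    moreover have "v \<bullet> (g x *v v) =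
        (g x $ 1 $ 1 * (v $ 1)\<^sup>2 + 2 * g x $ 1 $ 2 * v $ 1 * v $ 2 + g x $ 2 $ 2 * (v $ 2)\<^sup>2) +
        (g x $ 3 $ 3 * (v $ 3)\<^sup>2 + 2 * g x $ 3 $ 4 * v $ 3 * v $ 4 + g x $ 4 $ 4 * (v $ 4)\<^sup>2)"
      by (simp add: inner_vec_def sum_4 matrix_vector_block vector_4 g_blocks(3,4)[OF x]
        power2_eq_square algebra_simps)
    ultimately show "v \<bullet> (g x *v v) > 0" by linarith
  qed
  show "almost_complex U J"
    by (simp add: almost_complex_def smooth_J J_J)
  show "skew_symmetric U \<omega>"
    unfolding skew_symmetric_def forall_4 by (simp add: omega_eq vector_4)
  have "partial_deriv i (\<lambda>y. \<omega> y $ j $ k) x = 0" if "x \<in> U" for i j k x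
  proof -
    have "partial_deriv i (\<lambda>y. \<omega> y $ j $ k) x = partial_deriv i (\<lambda>y. \<omega> x $ j $ k) x"
      by (rule partial_deriv_cong[OF open_U that]) (simp add: omega_eq that)
    then show ?thesis by (simp add: partial_deriv_eq[OF has_derivative_const])
  qed
  then show "closed_form U \<omega>" by (simp add: closed_form_def)
qed

section \<open>The one-jet of the block structure and its Nijenhuis tensor\<close>

lemma DJ: "x \<in> U \<Longrightarrow> (J has_derivative DJ x) (at x)"
  by (rule smooth_tensor_has_derivative[OF smooth_J open_U])

abbreviation "d\<alpha> x \<equiv> frechet_derivative \<alpha> (at x)"
abbreviation "d\<beta> x \<equiv> frechet_derivative \<beta> (at x)"
abbreviation "d\<gamma> x \<equiv> frechet_derivative \<gamma> (at x)"
abbreviation "d\<delta> x \<equiv> frechet_derivative \<delta> (at x)"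

lemma has_derivative_functions:
  assumes "x \<in> U"
  shows "(\<alpha> has_derivative d\<alpha> x) (at x)" "(\<beta> has_derivative d\<beta> x) (at x)"
    "(\<gamma> has_derivative d\<gamma> x) (at x)" "(\<delta> has_derivative d\<delta> x) (at x)"
  using assms by (auto intro!: smooth_on_has_derivative[OF _ open_U] smooth_\<alpha> smooth_\<beta> smooth_\<gamma> smooth_\<delta>)

lemma linear_functions:
  assumes "x \<in> U"
  shows "linear (d\<alpha> x)" "linear (d\<beta> x)" "linear (d\<gamma> x)" "linear (d\<delta> x)"
  using has_derivative_functions[OF assms] by (auto intro: has_derivative_linear)

text \<open>\<open>N(\<partial>1, \<partial>3)\<close> applies derivatives of \<open>J\<close> to
  \<open>\<partial>1\<close> and \<open>\<partial>3\<close> only, so these two columns are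
  computed.\<close>

lemma DJ_axis:
  assumes x: "x \<in> U"
  shows "DJ x h *v coord_field 1 = vector [- (d\<alpha> x h * (sec (\<alpha> x))\<^sup>2),
      exp (- \<beta> x) * sec (\<alpha> x) * (tan (\<alpha> x) * d\<alpha> x h - d\<beta> x h), 0, 0]"
    and "DJ x h *v coord_field 3 = vector [0, 0, - (d\<gamma> x h * (sec (\<gamma> x))\<^sup>2),
      exp (- \<delta> x) * sec (\<gamma> x) * (tan (\<gamma> x) * d\<gamma> x h - d\<delta> x h)]"
proof -
  note c = cos_pos[OF x, THEN less_imp_neq, THEN not_sym]
  note d = has_derivative_functions[OF x]
  note ab = has_derivative_block_components[OF d(1,2) c(1)]
    and cd = has_derivative_block_components[OF d(3,4) c(2)]
  have "((\<lambda>y. J y $ k $ j) has_derivative (\<lambda>h. DJ x h $ k $ j)) (at x)" for j k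
    by (intro bounded_linear.has_derivative[OF bounded_linear_vec_nth] DJ x)
  note nth = fun_cong[OF has_derivative_unique[OF this]]
  have 0: "DJ x h $ k $ j = 0" if "\<And>y. J y $ k $ j = 0" for j k
    by (rule nth) (simp add: that)
  have "DJ x h $ 1 $ 1 = - (d\<alpha> x h * (sec (\<alpha> x))\<^sup>2)" "DJ x h $ 3 $ 3 = - (d\<gamma> x h * (sec (\<gamma> x))\<^sup>2)"
    by (rule nth, unfold J_nth g_nth, rule has_derivative_minus, fact)+
  moreover have "DJ x h $ 2 $ 1 = exp (- \<beta> x) * sec (\<alpha> x) * (tan (\<alpha> x) * d\<alpha> x h - d\<beta> x h)"
    "DJ x h $ 4 $ 3 = exp (- \<delta> x) * sec (\<gamma> x) * (tan (\<gamma> x) * d\<gamma> x h - d\<delta> x h)"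
    by (rule nth, unfold J_nth g_nth, fact)+
  ultimately show "DJ x h *v coord_field 1 = vector [- (d\<alpha> x h * (sec (\<alpha> x))\<^sup>2),
      exp (- \<beta> x) * sec (\<alpha> x) * (tan (\<alpha> x) * d\<alpha> x h - d\<beta> x h), 0, 0]"
    "DJ x h *v coord_field 3 = vector [0, 0, - (d\<gamma> x h * (sec (\<gamma> x))\<^sup>2),
      exp (- \<delta> x) * sec (\<gamma> x) * (tan (\<gamma> x) * d\<gamma> x h - d\<delta> x h)]"
    by (simp_all add: vec_eq_iff forall_4 vector_4 matrix_vector_axis_nth 0 J_nth)
qed

lemma J_axis:
  "J x *v coord_field 1 = - g x $ 1 $ 2 *\<^sub>R coord_field 1 + g x $ 1 $ 1 *\<^sub>R coord_field 2"
  "J x *v coord_field 2 = - g x $ 2 $ 2 *\<^sub>R coord_field 1 + g x $ 1 $ 2 *\<^sub>R coord_field 2"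
  "J x *v coord_field 3 = - g x $ 3 $ 4 *\<^sub>R coord_field 3 + g x $ 3 $ 3 *\<^sub>R coord_field 4"
  "J x *v coord_field 4 = - g x $ 4 $ 4 *\<^sub>R coord_field 3 + g x $ 3 $ 4 *\<^sub>R coord_field 4"
  unfolding matrix_vector_block by (simp_all add: vec_eq_iff forall_4 vector_4 axis_def)

abbreviation "nij x \<equiv> nijenhuis_jet (J x) (DJ x)"

definition eq_a :: "real^4 \<Rightarrow> bool" where
  "eq_a x \<longleftrightarrow>
    - d\<beta> x (coord_field 3) = d\<alpha> x (coord_field 4) * exp (- \<delta> x) * sec (\<gamma> x)
      - d\<alpha> x (coord_field 3) * tan (\<gamma> x) \<and>
    d\<beta> x (coord_field 4) = d\<alpha> x (coord_field 3) * exp (\<delta> x) * sec (\<gamma> x)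
      - d\<alpha> x (coord_field 4) * tan (\<gamma> x)"

definition eq_b :: "real^4 \<Rightarrow> bool" where
  "eq_b x \<longleftrightarrow>
    - d\<delta> x (coord_field 1) = d\<gamma> x (coord_field 2) * exp (- \<beta> x) * sec (\<alpha> x)
      - d\<gamma> x (coord_field 1) * tan (\<alpha> x) \<and>
    d\<delta> x (coord_field 2) = d\<gamma> x (coord_field 1) * exp (\<beta> x) * sec (\<alpha> x)
      - d\<gamma> x (coord_field 2) * tan (\<alpha> x)"

lemma condition_a_iff: "condition_a U \<alpha> \<beta> \<gamma> \<delta> \<longleftrightarrow> (\<forall>x\<in>U. eq_a x)"
  unfolding condition_a_def eq_a_def doubleton_eq_iff partial_deriv_def by auto

lemma condition_b_iff: "condition_b U \<alpha> \<beta> \<gamma> \<delta> \<longleftrightarrow> (\<forall>x\<in>U. eq_b x)"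
  unfolding condition_b_def eq_b_def doubleton_eq_iff partial_deriv_def by auto

lemma nij_13_iff:
  assumes x: "x \<in> U"
  shows "nij x (coord_field 1) (coord_field 3) = 0 \<longleftrightarrow> eq_a x \<and> eq_b x"
proof -
  define a b c where abc: "a = g x $ 1 $ 1" "b = g x $ 1 $ 2" "c = g x $ 2 $ 2"
  define A B C where ABC: "A = g x $ 3 $ 3" "B = g x $ 3 $ 4" "C = g x $ 4 $ 4"
  \<comment> \<open>Derivatives of the entries \<open>a\<close>, \<open>b\<close>, and likewise
    below of \<open>A\<close>, \<open>B\<close>.\<close>
  define da db where dab: "da h = exp (- \<beta> x) * sec (\<alpha> x) * (tan (\<alpha> x) * d\<alpha> x h - d\<beta> x h)"
    "db h = d\<alpha> x h * (sec (\<alpha> x))\<^sup>2" for h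
  define dA dB where dAB: "dA h = exp (- \<delta> x) * sec (\<gamma> x) * (tan (\<gamma> x) * d\<gamma> x h - d\<delta> x h)"
    "dB h = d\<gamma> x h * (sec (\<gamma> x))\<^sup>2" for h
  note D = DJ_axis[OF x, folded dab dAB]
  have "linear da" "linear db" "linear dA" "linear dB"
    using linear_functions[OF x] by (auto simp: dab dAB linear_iff algebra_simps)
  note lin = this[THEN linear_add] this[THEN linear_scale] this[THEN linear_diff]
  have J13: "J x *v coord_field 1 = - b *\<^sub>R coord_field 1 + a *\<^sub>R coord_field 2"
    "J x *v coord_field 3 = - B *\<^sub>R coord_field 3 + A *\<^sub>R coord_field 4"
    by (simp_all only: J_axis abc ABC)
  have nij: "nij x (coord_field 1) (coord_field 3) = vector [
      b * db (coord_field 3) - c * da (coord_field 3) - (B * db (coord_field 3) - A * db (coord_field 4)),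
      (B * da (coord_field 3) - A * da (coord_field 4)) - (a * db (coord_field 3) - b * da (coord_field 3)),
      (b * dB (coord_field 1) - a * dB (coord_field 2)) - (B * dB (coord_field 1) - C * dA (coord_field 1)),
      (A * dB (coord_field 1) - B * dA (coord_field 1)) - (b * dA (coord_field 1) - a * dA (coord_field 2))]"
    by (simp add: nijenhuis_jet_def D J13 lin)
      (simp add: matrix_vector_block vec_eq_iff forall_4 vector_4 flip: abc ABC)
  have "nij x (coord_field 1) (coord_field 3) = 0 \<longleftrightarrow>
    (B * db (coord_field 3) - A * db (coord_field 4) = b * db (coord_field 3) - c * da (coord_field 3) \<and>
     B * da (coord_field 3) - A * da (coord_field 4) = a * db (coord_field 3) - b * da (coord_field 3)) \<and>
    (b * dB (coord_field 1) - a * dB (coord_field 2) = B * dB (coord_field 1) - C * dA (coord_field 1) \<and>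
     b * dA (coord_field 1) - a * dA (coord_field 2) = A * dB (coord_field 1) - B * dA (coord_field 1))"
    unfolding nij vec_eq_iff forall_4 vector_4 zero_index
    by (intro iffI; elim conjE; intro conjI; linarith)
  then show ?thesis
    \<comment> \<open>The algebraic lemma serves twice, the second time with the two blocks
      interchanged.\<close>
    unfolding eq_a_def eq_b_def abc ABC g_nth dab dAB
      block_equations[OF sec_sq[OF x] exp_minus_inverse exp_minus_inverse]
      block_equations[OF sec_sq(2,1)[OF x] exp_minus_inverse exp_minus_inverse] .
qed

lemma nij_eq_0_iff:
  assumes x: "x \<in> U"
  shows "(\<forall>u v. nij x u v = 0) \<longleftrightarrow> eq_a x \<and> eq_b x"
proof
  assume "eq_a x \<and> eq_b x"
  then have n13: "nij x (coord_field 1) (coord_field 3) = 0"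
    by (simp add: nij_13_iff[OF x])
  interpret almost_kaehler_jet "g x" "J x" "frechet_derivative g (at x)" "DJ x"
    by (rule almost_kaehler_jet_at[OF open_U x almost_kaehler])
  \<comment> \<open>Vanishing on \<open>e\<close> passes to \<open>J e\<close> by
    conjugate-linearity, hence to \<open>f\<close>, whose coefficient in \<open>J e\<close> is
    \<open>g11\<close> or \<open>g33\<close> and so positive.\<close>
  have step: "nij x f v = 0"
    if "nij x e v = 0" "J x *v e = r *\<^sub>R e + s *\<^sub>R f" "s > 0" for e f v r s
  proof -
    note L = linear_nijenhuis_jet_left[OF linear_dJ, of "J x" v]
    have "nij x (J x *v e) v = 0"
      using nijenhuis_jet_J[OF linear_dJ J_J dJ_J] that(1) x by simp
    then have "s *\<^sub>R nij x f v = 0"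
      using that(1) L[THEN linear_add] L[THEN linear_scale] unfolding that(2) by simp
    then show ?thesis using that(3) by simp
  qed
  note step12 = step[OF _ J_axis(1) g_blocks(1)[OF x]]
    and step34 = step[OF _ J_axis(3) g_blocks(2)[OF x]]
  have anti: "nij x v u = 0" if "nij x u v = 0" for u v
    using nijenhuis_jet_antisym[of "J x" "DJ x" v u] that by simp
  have self: "nij x u u = 0" for u
    by (simp add: nijenhuis_jet_def)
  have n31: "nij x (coord_field 3) (coord_field 1) = 0" by (rule anti[OF n13])
  have n32: "nij x (coord_field 3) (coord_field 2) = 0" by (rule anti[OF step12[OF n13]])
  have n41: "nij x (coord_field 4) (coord_field 1) = 0" by (rule step34[OF n31])
  have n42: "nij x (coord_field 4) (coord_field 2) = 0" by (rule step34[OF n32])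
  \<comment> \<open>Within one plane the starting point is \<open>N(u, u) = 0\<close>.\<close>
  have n21: "nij x (coord_field 2) (coord_field 1) = 0" by (rule step12[OF self])
  have n43: "nij x (coord_field 4) (coord_field 3) = 0" by (rule step34[OF self])
  have "\<forall>i j. nij x (coord_field i) (coord_field j) = 0"
    unfolding forall_4 by (intro conjI self n31 n32 n41 n42 n21 n43 anti[OF n31] anti[OF n32]
        anti[OF n41] anti[OF n42] anti[OF n21] anti[OF n43])
  then have "nij x u (coord_field j) = 0" for u j
    using linear_eq_0_axis[OF linear_nijenhuis_jet_left[OF linear_dJ, of "J x" "coord_field j"]]
    by blast
  then show "\<forall>u v. nij x u v = 0"
    using linear_eq_0_axis[OF linear_nijenhuis_jet_right[OF linear_dJ, of "J x"]] by blast
qed (simp add: nij_13_iff[OF x, symmetric])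

proposition integrable_iff: "integrable_J U J \<longleftrightarrow> condition_a U \<alpha> \<beta> \<gamma> \<delta> \<and> condition_b U \<alpha> \<beta> \<gamma> \<delta>"
  using almost_kaehler unfolding almost_kaehler_def
  by (auto simp: integrable_J_iff[OF open_U] nij_eq_0_iff condition_a_iff condition_b_iff)

section \<open>Cauchy-Riemann equations on the coordinate planes\<close>

lemma J_preserves:
  "v \<in> span {coord_field 1, coord_field 2} \<Longrightarrow> J x *v v \<in> span {coord_field 1, coord_field 2}"
  "v \<in> span {coord_field 3, coord_field 4} \<Longrightarrow> J x *v v \<in> span {coord_field 3, coord_field 4}"
  by (simp_all add: span_coord_fields_iff forall_4 matrix_vector_block vector_4)

proposition V_holomorphic_iff:
  "leafwise_holomorphic U J dist_V (\<lambda>x. Complex (\<alpha> x) (\<beta> x)) \<longleftrightarrow> condition_a U \<alpha> \<beta> \<gamma> \<delta>"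
proof -
  have "eq_a x \<longleftrightarrow> d\<alpha> x (J x *v coord_field 3) = - d\<beta> x (coord_field 3) \<and>
      d\<alpha> x (J x *v coord_field 4) = - d\<beta> x (coord_field 4)" if "x \<in> U" for x
    using linear_functions(1)[OF that]
    by (auto simp: J_axis eq_a_def linear_add linear_diff linear_scale g_nth algebra_simps)
  moreover have "(\<forall>v\<in>span {coord_field 3, coord_field 4}.
      Complex (d\<alpha> x (J x *v v)) (d\<beta> x (J x *v v)) = \<i> * Complex (d\<alpha> x v) (d\<beta> x v)) \<longleftrightarrow>
      d\<alpha> x (J x *v coord_field 3) = - d\<beta> x (coord_field 3) \<and>
      d\<alpha> x (J x *v coord_field 4) = - d\<beta> x (coord_field 4)" if "x \<in> U" for x
    by (rule cauchy_riemann_on_plane[OF linear_functions(1,2)[OF that] J_J[OF that] J_preserves(2)])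
  moreover have "leafwise_holomorphic U J (\<lambda>_. span {coord_field 3, coord_field 4})
      (\<lambda>x. Complex (\<alpha> x) (\<beta> x)) \<longleftrightarrow> (\<forall>x\<in>U. \<forall>v\<in>span {coord_field 3, coord_field 4}.
      Complex (d\<alpha> x (J x *v v)) (d\<beta> x (J x *v v)) = \<i> * Complex (d\<alpha> x v) (d\<beta> x v))"
    by (rule leafwise_holomorphic_iff[OF _ open_U has_derivative_Complex[OF
          has_derivative_functions(1) has_derivative_functions(2)] J_preserves(2)]) simp_all
  moreover have "dist_V = (\<lambda>_. span {coord_field 3, coord_field 4})"
    by (simp add: fun_eq_iff dist_V_def)
  ultimately show ?thesis
    unfolding condition_a_iff by simp
qed

proposition H_holomorphic_iff:
  "leafwise_holomorphic U J dist_H (\<lambda>x. Complex (\<gamma> x) (\<delta> x)) \<longleftrightarrow> condition_b U \<alpha> \<beta> \<gamma> \<delta>"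
proof -
  have "eq_b x \<longleftrightarrow> d\<gamma> x (J x *v coord_field 1) = - d\<delta> x (coord_field 1) \<and>
      d\<gamma> x (J x *v coord_field 2) = - d\<delta> x (coord_field 2)" if "x \<in> U" for x
    using linear_functions(3)[OF that]
    by (auto simp: J_axis eq_b_def linear_add linear_diff linear_scale g_nth algebra_simps)
  moreover have "(\<forall>v\<in>span {coord_field 1, coord_field 2}.
      Complex (d\<gamma> x (J x *v v)) (d\<delta> x (J x *v v)) = \<i> * Complex (d\<gamma> x v) (d\<delta> x v)) \<longleftrightarrow>
      d\<gamma> x (J x *v coord_field 1) = - d\<delta> x (coord_field 1) \<and>
      d\<gamma> x (J x *v coord_field 2) = - d\<delta> x (coord_field 2)" if "x \<in> U" for x
    by (rule cauchy_riemann_on_plane[OF linear_functions(3,4)[OF that] J_J[OF that] J_preserves(1)])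
  moreover have "leafwise_holomorphic U J (\<lambda>_. span {coord_field 1, coord_field 2})
      (\<lambda>x. Complex (\<gamma> x) (\<delta> x)) \<longleftrightarrow> (\<forall>x\<in>U. \<forall>v\<in>span {coord_field 1, coord_field 2}.
      Complex (d\<gamma> x (J x *v v)) (d\<delta> x (J x *v v)) = \<i> * Complex (d\<gamma> x v) (d\<delta> x v))"
    by (rule leafwise_holomorphic_iff[OF _ open_U has_derivative_Complex[OF
          has_derivative_functions(3) has_derivative_functions(4)] J_preserves(1)]) simp_all
  moreover have "dist_H = (\<lambda>_. span {coord_field 1, coord_field 2})"
    by (simp add: fun_eq_iff dist_H_def)
  ultimately show ?thesis
    unfolding condition_b_iff by simp
qed

end

theorem theoremD:
  fixes U :: "(real ^ 4) set"
    and \<alpha> \<beta> \<gamma> \<delta> :: "real ^ 4 \<Rightarrow> real"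
    and g J \<omega> :: tensor_field
  assumes "open U"
    and "smooth_on U \<alpha>" and "smooth_on U \<beta>" and "smooth_on U \<gamma>" and "smooth_on U \<delta>"
    and "\<alpha> ` U \<subseteq> {- pi / 2 <..< pi / 2}" and "\<gamma> ` U \<subseteq> {- pi / 2 <..< pi / 2}"
  defines "g \<equiv> metric_M \<alpha> \<beta> \<gamma> \<delta>"
    and "J \<equiv> acs_J g"
    and "\<omega> \<equiv> fundamental_form g J"
  defines "cond_i \<equiv> condition_a U \<alpha> \<beta> \<gamma> \<delta> \<and> condition_b U \<alpha> \<beta> \<gamma> \<delta>"
    and "cond_ii \<equiv> parallel_form U g \<omega>"
    and "cond_iii \<equiv> parallel_endomorphism U g J"
    and "cond_iv \<equiv> integrable_J U J"
    and "V_hol \<equiv> leafwise_holomorphic U J dist_V (\<lambda>x. Complex (\<alpha> x) (\<beta> x))"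
    and "H_hol \<equiv> leafwise_holomorphic U J dist_H (\<lambda>x. Complex (\<gamma> x) (\<delta> x))"
  shows "almost_kaehler U g J \<and>
    (cond_i \<longleftrightarrow> cond_ii) \<and> (cond_ii \<longleftrightarrow> cond_iii) \<and> (cond_iii \<longleftrightarrow> cond_iv) \<and>
    (cond_iv \<longleftrightarrow> V_hol \<and> H_hol) \<and>
    (V_hol \<longleftrightarrow> condition_a U \<alpha> \<beta> \<gamma> \<delta>) \<and> (H_hol \<longleftrightarrow> condition_b U \<alpha> \<beta> \<gamma> \<delta>)"
proof -
  interpret block_metric U \<alpha> \<beta> \<gamma> \<delta>
    by unfold_locales (fact assms)+
  show ?thesis
    using almost_kaehler almost_kaehler_parallel_iff_integrable[OF assms(1) almost_kaehler]
      integrable_iff V_holomorphic_iff H_holomorphic_iff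
    unfolding g_def J_def \<omega>_def cond_i_def cond_ii_def cond_iii_def cond_iv_def V_hol_def H_hol_def
    by blast
qed

end
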